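(* Let $n\ge2$, $N=n+1$, $k_1\ge\dots\ge k_n\ge1$ integers, $m_i=\sum_{j=i}^nk_j$, $m=m_1$. The bijection $\Psi:\mathcal{N}_k\to\mathcal{N}^{\mathrm H}_{(m_1,\dots,m_n)}$ from equivalence classes of $k$-Nahm complexes to equivalence classes of Nahm complexes of type $(m_1,\dots,m_n)$ in the sense of Hurtubise, induced by the map $\Phi:\mathcal{B}_k\to\mathcal{B}_k^{\mathrm H}$, preserves the symplectic form given, respectively, by $$\int_{\lambda_1}^{\lambda_N}\mathrm{Tr}(\mathrm{d}\alpha\wedge \mathrm{d}\beta)\,\mathrm{d}t .$$ That is, if $\omega^{\mathcal{B}_k}$ and $\omega^{\mathcal{B}^{\mathrm H}_k}$ are the 2-forms on $\mathcal{B}_k$ and $\mathcal{B}_k^{\mathrm H}$ given at $(\alpha,\beta)$ on tangent vectors $(a,b),(a',b')$ by $\int_{\lambda_1}^{\lambda_N}\mathrm{Tr}(ab'-a'b)\,\mathrm{d}t$, then $\Phi^*\omega^{\mathcal{B}_k^{\mathrm H}}=\omega^{\mathcal{B}_k}$.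
   Context: **Notation.** $\lambda=(\lambda_1,\lambda_N)$ bounded open interval; $m_N=0$. $m\times m$ matrices are viewed as $n\times n$ block matrices with diagonal blocks of sizes $k_n,\dots,k_1$ (the $i$-th has size $k_{N-i}$, occupying indices $m_{N-i+1}+1,\dots,m_{N-i}$). $x(\ell)=\mathrm{diag}(-\frac{\ell-1}4,-\frac{\ell-3}4,\dots,\frac{\ell-1}4)$; $y(\ell)$ is the $\ell\times\ell$ matrix with ones on the first subdiagonal, zeros elsewhere; $x_1=-x(m)$, $y_1=y(m)^T$, $x_N=\mathrm{diag}(x(k_n),\dots,x(k_1))$, $y_N=\mathrm{diag}(y(k_n),\dots,y(k_1))$. Complex equation: $\dot\beta+2[\alpha,\beta]=0$. Action: $g.(\alpha,\beta)=(g\alpha g^{-1}-\frac12\dot gg^{-1},g\beta g^{-1})$. $z^aO(1)$ means $z^a$ times a convergent power series in $z$ (fixed branch of $z^{1/2}$). **$\mathcal{N}_k$.** A $k$-Nahm complex is $((\alpha,\beta),v)$ with $\alpha,\beta\in C^\infty(\lambda,\mathfrak{gl}(m,\mathbb{C}))$ solving the complex equation, $v\in(\mathbb{C}^m)^*\times(\mathbb{C}^m)^n$, and: (i) $\alpha,\beta$ meromorphic near $\lambda_1$ (with simple poles at $\lambda_1$) with residues simultaneously $GL(m,\mathbb{C})$-conjugate to $x_1,y_1$; (ii) for some $g\in GL(m,\mathbb{C})$ and $z<0$ small, $g\alpha(\lambda_N+z)g^{-1}-\frac{x_N}z$ and $g\beta(\lambda_N+z)g^{-1}-\frac{y_N}z$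 have $(p,q)$-block $z^{|k_{N-p}-k_{N-q}|/2}O(1)$; (iii) $v_1^T$ lies in the $\frac{m-1}4$-eigenspace of $\mathrm{res}_{\lambda_1}(\alpha)^T$ and is cyclic for $\mathrm{res}_{\lambda_1}(\beta)^T$; (iv) $v_{i+1}$ lies in the $-\frac{k_i-1}4$-eigenspace of $\mathrm{res}_{\lambda_N}(\alpha)$, $\mathrm{res}_{\lambda_N}(\beta)^{k_i}v_{i+1}=0$ ($1\le i\le n$), and the vectors $\mathrm{res}_{\lambda_N}(\beta)^{a}v_{i+1}$, $0\le a<k_i$, $1\le i\le n$, form a basis of $\mathbb{C}^m$. Two are equivalent if related by a smooth $g:\lambda\to GL(m,\mathbb{C})$ extending continuously and invertibly to $\overline\lambda$, acting on $v$ by $(v_1g^{-1},gv_2,\dots,gv_N)$ (boundary values of $g$ at $\lambda_1$ resp. $\lambda_N$). $\mathcal{N}_k$ is the quotient. **$\mathcal{N}^{\mathrm H}$.** Fix $\varepsilon>0$ with $\lambda_N-n\varepsilon>\lambda_1$; $\lambda_1(\varepsilon)=\lambda_1$, $\lambda_N(\varepsilon)=\lambda_N$, $\lambda_i(\varepsilon)=\lambda_N-(N-i)\varepsilon$ for $2\le i\le n$; $I_i=(\lambda_i(\varepsilon),\lambda_{i+1}(\varepsilon))$. A Nahm complex of type $(m_1,\dots,m_n)$ is $((\alpha_i,\beta_i)_{i=1}^n,(v_1,\dots,v_N))$ with $(\alpha_i,\beta_i)$ smooth $\mathfrak{gl}(m_i,\mathbb{C})$-valued solutions of the complex equation on $I_i$,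 $v_1\in\mathbb{C}^m$, $v_{i+1}\in\mathbb{C}^{m_i}$, such that: $\alpha_1,\beta_1$ are meromorphic near $\lambda_1$ (with simple poles) with residues simultaneously conjugate to $x(m),y(m)$, and $v_1\neq0$ lies in the $-\frac{m-1}4$-eigenspace of $\mathrm{res}_{\lambda_1}\alpha_1$; for $i\ge2$, $(\alpha_i,\beta_i)$ extends analytically to $\lambda_i(\varepsilon)$; for $1\le i\le n$, with respect to $\mathbb{C}^{m_i}=\mathbb{C}^{m_{i+1}}\oplus\mathbb{C}^{k_i}$ and $z<0$ small, $\alpha_i(\lambda_{i+1}(\varepsilon)+z)$ has upper left block $\alpha_{i+1}(\lambda_{i+1}(\varepsilon))+zO(1)$, off-diagonal blocks $z^{(k_i-1)/2}O(1)$ and lower right block $\frac{X_i}z+O(1)$, and likewise $\beta_i$ with $\beta_{i+1}$ and $\frac{Y_i}z$, where $(X_i,Y_i)$ is simultaneously $GL(k_i,\mathbb{C})$-conjugate to $(x(k_i),y(k_i))$, and $v_{i+1}\ne0$ lies in the $-\frac{k_i-1}4$-eigenspace of $X_i$ in $0\oplus\mathbb{C}^{k_i}$ (for $i=n$ only the last block is present). Equivalence: by tuples $(g_i)$ of smooth $g_i:I_i\to GL(m_i,\mathbb{C})$ extending continuously and invertibly to $\overline{I_i}$ with $g_i(\lambda_{i+1}(\varepsilon))=\mathrm{diag}(g_{i+1}(\lambda_{i+1}(\varepsilon)),h_i)$, $h_i\in GL(k_i,\mathbb{C})$ for $i<n$, acting on $(\alpha_i,\beta_i)$ by $g_i.(\alpha_i,\beta_i)=(g_i\alpha_ig_i^{-1}-\frac12\dot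 g_ig_i^{-1},g_i\beta_ig_i^{-1})$ and on $v_1,v_{i+1}$ by $g_1(\lambda_1)v_1$, $g_i(\lambda_{i+1}(\varepsilon))v_{i+1}$. The quotient is $\mathcal{N}^{\mathrm H}_{(m_1,\dots,m_n)}$. **$\mathcal{B}_k$.** Let $\mathfrak{M}_k$ be the set of $m\times m$ matrices $B$ whose diagonal blocks are companion type (ones on the subdiagonal, arbitrary last column, zeros elsewhere), whose $(i,j)$-blocks for $i<j$ vanish except for the last column, and whose $(i,j)$-blocks for $i>j$ vanish except for the first $k_{N-j}$ entries of the last column. $\mathcal{B}_k$ is the set of smooth solutions $(\alpha,\beta)$ on $\lambda$ of the complex equation such that near $\lambda_1$, $\alpha(\lambda_1+z)=-x_1/z$ and $\beta(\lambda_1+z)$ has subdiagonal entries $z^{-1}$, last column $(-z^{m-1}q_1,\dots,-zq_{m-1},-q_m)^T$ for some $q\in\mathbb{C}^m$, zeros elsewhere; and on $(\lambda_N-n\varepsilon,\lambda_N)$, $\alpha(\lambda_N+z)=x_N/z$, $\beta(\lambda_N+z)=z^{-2x_N}Bz^{2x_N}$ for a constant $B\in\mathfrak{M}_k$. $b\in\mathcal{B}_k$ represents the class in $\mathcal{N}_k$ of $(b,(e_m^T,e_{m_2+1},\dots,e_{m_N+1}))$ (i.e. $v_{i+1}=e_{m_{i+1}+1}$). **$\Phi$.** $\Phi$ is the composition of four maps. (1) $b\mapsto g_{\mathrm{reg}}.b$, with $g_{\mathrm{reg}}:\lambda\to GL(m,\mathbb{C})$ fixed smooth, $g_{\mathrm{reg}}(\lambda_1+z)=z^{-2x_1}$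 near $\lambda_1$, $g_{\mathrm{reg}}(\lambda_N+z)=z^{2x_N}$ on $(\lambda_N-n\varepsilon,\lambda_N)$. (2) $(\alpha,\beta)\mapsto g.(\alpha,\beta)$ where $g=g(\alpha,\beta):\lambda\to GL(m,\mathbb{C})$ is smooth, chosen to depend smoothly on $(\alpha,\beta)$, equal to $\mathbb{1}$ near $\lambda_1$ and to the constant $\gamma_B$ on $(\lambda_N-n\varepsilon,\lambda_N)$, $B\in\mathfrak{M}_k$ being the constant value of $\beta$ there. Here $\gamma_B$ is the product (later factors on the left) of matrices $g^{(i,j)}$ over the pairs $i>j$ in the order $(2,1),(3,1),(3,2),(4,1),\dots,(n,n-1)$: if $A$ is the conjugate of $B$ by the previous factors, then $g^{(i,j)}$ is the identity except for its $(i,j)$-block, whose $(p,p+r)$ entry is $\nu_r$ for $r\ge1$, $p\ge1$, $p+r\le k_{N-j}$ (other entries $0$), with $\nu_r=c_{k_{N-j}+1-r}+\sum_{s=1}^{r-1}d_{k_{N-j}+1-s}\,\nu_{r-s}$, $c$ and $d$ being the last columns of the $(i,j)$- and $(j,j)$-block of $A$. ($\gamma_BB\gamma_B^{-1}$ then has $(i,j)$-blocks for $i>j$ with only the first row possibly non-zero.) (3) $(\alpha,\beta)\mapsto([\alpha|_{I_i}]_{m_i},[\beta|_{I_i}]_{m_i})_{i=1}^n$, where $[\cdot]_\ell$ is the upper left $\ell\times\ell$ block. (4) The action of fixed smooth $g_i^{\mathrm H}:I_i\to GL(m_i,\mathbb{C})$ with $g_1^{\mathrm H}(\lambda_1+z)=z^{-2x(m)}$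 near $\lambda_1$, $g_i^{\mathrm H}=\mathbb{1}$ near $\lambda_i(\varepsilon)$ for $i\ge2$, and $g_i^{\mathrm H}(\lambda_{i+1}(\varepsilon)+z)=\mathrm{diag}(\mathbb{1}_{m_{i+1}},z^{-2x(k_i)})$ near $\lambda_{i+1}(\varepsilon)$. $\mathcal{B}^{\mathrm H}_k$ is the image of $\Phi$; its elements, together with $(e_1,e_{m_2+1},\dots,e_{m_N+1})$, represent classes in $\mathcal{N}^{\mathrm H}_{(m_1,\dots,m_n)}$, and $\Psi$ sends the class of $b\in\mathcal{B}_k$ to the class of $\Phi(b)$. On $\mathcal{B}_k^{\mathrm H}$, $(\alpha,\beta)$ denotes $(\alpha_i,\beta_i)$ on $I_i$, and the integral over $(\lambda_1,\lambda_N)$ is the sum of the integrals over the $I_i$. *)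

theory Defs
  imports "HOL-Analysis.Analysis" "Jordan_Normal_Form.VS_Connect"
begin

section \<open>Conventions\<close>

text \<open>
  Matrices are those of \<^theory>\<open>Jordan_Normal_Form.Matrix\<close>, with indices counted from 0;
  blocks, intervals, and the vectors \<open>v\<^sub>1, \<dots>, v\<^sub>N\<close> keep their numbering from 1, and \<open>N = n + 1\<close>.
  The data are \<open>n\<close>, \<open>k :: nat \<Rightarrow> nat\<close> (used on \<open>{1..n}\<close>), the end points \<open>l1\<close>, \<open>lN\<close> of the interval
  and \<open>eps\<close>.  Functions on an open interval are functions on the reals whose values outside the
  interval are never used.  The branch of a non-integral power \<open>z\<^sup>a\<close> is the principal one
  (\<^term>\<open>(powr) :: complex \<Rightarrow> complex \<Rightarrow> complex\<close>), so that for \<open>z < 0\<close> the root of \<open>z\<close> is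
  \<open>\<i> \<surd>\<bar>z\<bar>\<close>.
\<close>

type_synonym mat_fun = "real \<Rightarrow> complex mat"
type_synonym nahm_pair = "mat_fun \<times> mat_fun"
type_synonym nahm_data = "nahm_pair \<times> (nat \<Rightarrow> complex vec)"
type_synonym hurtubise_data = "(nat \<Rightarrow> nahm_pair) \<times> (nat \<Rightarrow> complex vec)"

section \<open>Smooth matrix functions and the gauge action\<close>

text \<open>Only used for open sets \<open>S\<close>, of one real variable or of two.\<close>

primrec C_diff_on ::
  "'a::real_normed_vector set \<Rightarrow> ('a \<Rightarrow> 'b::real_normed_vector) \<Rightarrow> nat \<Rightarrow> bool" where
  "C_diff_on S f 0 \<longleftrightarrow> continuous_on S f"
| "C_diff_on S f (Suc r) \<longleftrightarrow>
     (\<forall>x\<in>S. f differentiable (at x)) \<and>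
     (\<forall>w. C_diff_on S (\<lambda>x. frechet_derivative f (at x) w) r)"

definition smooth_on ::
  "'a::real_normed_vector set \<Rightarrow> ('a \<Rightarrow> 'b::real_normed_vector) \<Rightarrow> bool" where
  "smooth_on S f \<longleftrightarrow> (\<forall>r. C_diff_on S f r)"

definition smooth_mat :: "nat \<Rightarrow> 'a::real_normed_vector set \<Rightarrow> ('a \<Rightarrow> complex mat) \<Rightarrow> bool" where
  "smooth_mat d S f \<longleftrightarrow>
     (\<forall>x\<in>S. f x \<in> carrier_mat d d) \<and>
     (\<forall>i<d. \<forall>j<d. smooth_on S (\<lambda>x. f x $$ (i,j)))"

definition mat_deriv :: "mat_fun \<Rightarrow> mat_fun" where
  "mat_deriv f t = mat (dim_row (f t)) (dim_col (f t))
     (\<lambda>(i,j). vector_derivative (\<lambda>s. f s $$ (i,j)) (at t))"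

definition GL :: "nat \<Rightarrow> complex mat set" where
  "GL d = {A \<in> carrier_mat d d. invertible_mat A}"

definition minv :: "complex mat \<Rightarrow> complex mat" where
  "minv A = (THE B. inverts_mat A B \<and> inverts_mat B A)"

definition mtrace :: "complex mat \<Rightarrow> complex" where
  "mtrace A = (\<Sum>i<dim_row A. A $$ (i,i))"

definition complex_equation :: "real set \<Rightarrow> nat \<Rightarrow> mat_fun \<Rightarrow> mat_fun \<Rightarrow> bool" where
  "complex_equation S d \<alpha> \<beta> \<longleftrightarrow>
     (\<forall>t\<in>S. mat_deriv \<beta> t + 2 \<cdot>\<^sub>m (\<alpha> t * \<beta> t - \<beta> t * \<alpha> t) = 0\<^sub>m d d)"

definition gauge :: "mat_fun \<Rightarrow> nahm_pair \<Rightarrow> nahm_pair" where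
  "gauge g p =
     ((\<lambda>t. g t * fst p t * minv (g t) - (1/2) \<cdot>\<^sub>m (mat_deriv g t * minv (g t))),
      (\<lambda>t. g t * snd p t * minv (g t)))"

section \<open>Block structure and model matrices\<close>

definition msize :: "nat \<Rightarrow> (nat \<Rightarrow> nat) \<Rightarrow> nat \<Rightarrow> nat" where
  "msize n k i = (\<Sum>j=i..n. k j)"

definition bsize :: "nat \<Rightarrow> (nat \<Rightarrow> nat) \<Rightarrow> nat \<Rightarrow> nat" where
  "bsize n k p = k (n + 1 - p)"

definition boff :: "nat \<Rightarrow> (nat \<Rightarrow> nat) \<Rightarrow> nat \<Rightarrow> nat" where
  "boff n k p = msize n k (n + 2 - p)"

definition block :: "nat \<Rightarrow> (nat \<Rightarrow> nat) \<Rightarrow> complex mat \<Rightarrow> nat \<Rightarrow> nat \<Rightarrow> complex mat" where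
  "block n k A p q = mat (bsize n k p) (bsize n k q)
     (\<lambda>(r,s). A $$ (boff n k p + r, boff n k q + s))"

definition xmat :: "nat \<Rightarrow> complex mat" where
  "xmat l = mat l l (\<lambda>(i,j). if i = j then (2 * of_nat i + 1 - of_nat l) / 4 else 0)"

definition ymat :: "nat \<Rightarrow> complex mat" where
  "ymat l = mat l l (\<lambda>(i,j). if i = j + 1 then 1 else 0)"

definition x1_mat :: "nat \<Rightarrow> (nat \<Rightarrow> nat) \<Rightarrow> complex mat" where
  "x1_mat n k = - xmat (msize n k 1)"

definition y1_mat :: "nat \<Rightarrow> (nat \<Rightarrow> nat) \<Rightarrow> complex mat" where
  "y1_mat n k = transpose_mat (ymat (msize n k 1))"

definition xN_mat :: "nat \<Rightarrow> (nat \<Rightarrow> nat) \<Rightarrow> complex mat" where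
  "xN_mat n k = diag_block_mat (map (\<lambda>p. xmat (bsize n k p)) [1..<n+1])"

definition yN_mat :: "nat \<Rightarrow> (nat \<Rightarrow> nat) \<Rightarrow> complex mat" where
  "yN_mat n k = diag_block_mat (map (\<lambda>p. ymat (bsize n k p)) [1..<n+1])"

text \<open>\<open>diag_powr t X\<close> is \<open>t\<^sup>X\<close> for a diagonal matrix \<open>X\<close> and real \<open>t \<noteq> 0\<close>.\<close>

definition diag_powr :: "real \<Rightarrow> complex mat \<Rightarrow> complex mat" where
  "diag_powr t X = mat (dim_row X) (dim_row X)
     (\<lambda>(i,j). if i = j then complex_of_real t powr (X $$ (i,i)) else 0)"

section \<open>Behaviour near an end point\<close>

definition residue_right :: "nat \<Rightarrow> real \<Rightarrow> mat_fun \<Rightarrow> complex mat" where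
  "residue_right d l f = mat d d (\<lambda>(i,j). Lim (at_right l) (\<lambda>t. of_real (t - l) * f t $$ (i,j)))"

definition residue_left :: "nat \<Rightarrow> real \<Rightarrow> mat_fun \<Rightarrow> complex mat" where
  "residue_left d l f = mat d d (\<lambda>(i,j). Lim (at_left l) (\<lambda>t. of_real (t - l) * f t $$ (i,j)))"

definition value_right :: "nat \<Rightarrow> real \<Rightarrow> mat_fun \<Rightarrow> complex mat" where
  "value_right d l f = mat d d (\<lambda>(i,j). Lim (at_right l) (\<lambda>t. f t $$ (i,j)))"

definition simple_pole_right :: "nat \<Rightarrow> real \<Rightarrow> mat_fun \<Rightarrow> bool" where
  "simple_pole_right d l f \<longleftrightarrow> (\<forall>i<d. \<forall>j<d. \<exists>F. F analytic_on {0} \<and>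
     (\<forall>\<^sub>F t in at_right l. f t $$ (i,j) = F (complex_of_real (t - l)) / of_real (t - l)))"

definition analytic_right :: "nat \<Rightarrow> real \<Rightarrow> mat_fun \<Rightarrow> bool" where
  "analytic_right d l f \<longleftrightarrow> (\<forall>i<d. \<forall>j<d. \<exists>F. F analytic_on {0} \<and>
     (\<forall>\<^sub>F t in at_right l. f t $$ (i,j) = F (complex_of_real (t - l))))"

text \<open>\<open>power_O l a f\<close>: \<open>f (l + z)\<close> is of the form \<open>z\<^sup>a O(1)\<close> for small \<open>z < 0\<close>.\<close>

definition power_O :: "real \<Rightarrow> real \<Rightarrow> (real \<Rightarrow> complex) \<Rightarrow> bool" where
  "power_O l a f \<longleftrightarrow> (\<exists>F. F analytic_on {0} \<and>
     (\<forall>\<^sub>F t in at_left l.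
        f t = complex_of_real (t - l) powr complex_of_real a * F (complex_of_real (t - l))))"

definition sim_conj ::
  "nat \<Rightarrow> complex mat \<Rightarrow> complex mat \<Rightarrow> complex mat \<Rightarrow> complex mat \<Rightarrow> bool" where
  "sim_conj d A B A' B' \<longleftrightarrow> (\<exists>g\<in>GL d. g * A * minv g = A' \<and> g * B * minv g = B')"

section \<open>k-Nahm complexes\<close>

definition pole_left_cond ::
  "nat \<Rightarrow> (nat \<Rightarrow> nat) \<Rightarrow> real \<Rightarrow> complex mat \<Rightarrow> mat_fun \<Rightarrow> complex mat \<Rightarrow> bool" where
  "pole_left_cond n k lN g f X \<longleftrightarrow>
     (\<forall>p\<in>{1..n}. \<forall>q\<in>{1..n}. \<forall>r<bsize n k p. \<forall>s<bsize n k q.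
        power_O lN (\<bar>real (bsize n k p) - real (bsize n k q)\<bar> / 2)
          (\<lambda>t. block n k (g * f t * minv g - of_real (1 / (t - lN)) \<cdot>\<^sub>m X) p q $$ (r,s)))"

definition k_nahm_complex ::
  "nat \<Rightarrow> (nat \<Rightarrow> nat) \<Rightarrow> real \<Rightarrow> real \<Rightarrow> nahm_data \<Rightarrow> bool" where
  "k_nahm_complex n k l1 lN c \<longleftrightarrow>
     (let m = msize n k 1; \<alpha> = fst (fst c); \<beta> = snd (fst c); v = snd c;
          A1 = residue_right m l1 \<alpha>; B1 = residue_right m l1 \<beta>;
          AN = residue_left m lN \<alpha>; BN = residue_left m lN \<beta>
      in smooth_mat m {l1<..<lN} \<alpha> \<and> smooth_mat m {l1<..<lN} \<beta> \<and>
         complex_equation {l1<..<lN} m \<alpha> \<beta> \<and>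
         (\<forall>i\<in>{1..n+1}. v i \<in> carrier_vec m) \<and>
         simple_pole_right m l1 \<alpha> \<and> simple_pole_right m l1 \<beta> \<and>
         sim_conj m A1 B1 (x1_mat n k) (y1_mat n k) \<and>
         (\<exists>g\<in>GL m. pole_left_cond n k lN g \<alpha> (xN_mat n k) \<and>
                   pole_left_cond n k lN g \<beta> (yN_mat n k)) \<and>
         transpose_mat A1 *\<^sub>v v 1 = ((of_nat m - 1) / 4) \<cdot>\<^sub>v v 1 \<and>
         LinearCombinations.module.span class_ring (module_vec TYPE(complex) m)
           {(transpose_mat B1 ^\<^sub>m a) *\<^sub>v v 1 |a. True} = carrier_vec m \<and>
         (\<forall>i\<in>{1..n}. AN *\<^sub>v v (i+1) = (- (of_nat (k i) - 1) / 4) \<cdot>\<^sub>v v (i+1) \<and>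
                      (BN ^\<^sub>m k i) *\<^sub>v v (i+1) = 0\<^sub>v m) \<and>
         inj_on (\<lambda>(i,a). (BN ^\<^sub>m a) *\<^sub>v v (i+1)) (SIGMA i:{1..n}. {..<k i}) \<and>
         VectorSpace.vectorspace.basis class_ring (module_vec TYPE(complex) m)
           ((\<lambda>(i,a). (BN ^\<^sub>m a) *\<^sub>v v (i+1)) ` (SIGMA i:{1..n}. {..<k i})))"

text \<open>The covector \<open>v\<^sub>1\<close> is stored as the column \<open>v\<^sub>1\<^sup>T\<close>, on which \<open>v\<^sub>1 \<mapsto> v\<^sub>1 g\<^sup>-\<^sup>1\<close> is
  multiplication by the transpose of the inverse.\<close>

definition k_nahm_rel ::
  "nat \<Rightarrow> (nat \<Rightarrow> nat) \<Rightarrow> real \<Rightarrow> real \<Rightarrow> (nahm_data \<times> nahm_data) set" where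
  "k_nahm_rel n k l1 lN = {(c, c').
     k_nahm_complex n k l1 lN c \<and> k_nahm_complex n k l1 lN c' \<and>
     (\<exists>g. smooth_mat (msize n k 1) {l1<..<lN} g \<and>
          (\<forall>t\<in>{l1..lN}. g t \<in> GL (msize n k 1)) \<and>
          (\<forall>i<msize n k 1. \<forall>j<msize n k 1. continuous_on {l1..lN} (\<lambda>t. g t $$ (i,j))) \<and>
          (\<forall>t\<in>{l1<..<lN}. fst (fst c') t = fst (gauge g (fst c)) t \<and>
                          snd (fst c') t = snd (gauge g (fst c)) t) \<and>
          snd c' 1 = transpose_mat (minv (g l1)) *\<^sub>v snd c 1 \<and>
          (\<forall>i\<in>{1..n}. snd c' (i+1) = g lN *\<^sub>v snd c (i+1)))}"

definition N_k :: "nat \<Rightarrow> (nat \<Rightarrow> nat) \<Rightarrow> real \<Rightarrow> real \<Rightarrow> nahm_data set set" where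
  "N_k n k l1 lN = {c. k_nahm_complex n k l1 lN c} // k_nahm_rel n k l1 lN"

section \<open>Nahm complexes in the sense of Hurtubise\<close>

definition lam :: "nat \<Rightarrow> real \<Rightarrow> real \<Rightarrow> real \<Rightarrow> nat \<Rightarrow> real" where
  "lam n l1 lN eps i = (if i \<le> 1 then l1 else lN - (real (n + 1) - real i) * eps)"

definition I_open :: "nat \<Rightarrow> real \<Rightarrow> real \<Rightarrow> real \<Rightarrow> nat \<Rightarrow> real set" where
  "I_open n l1 lN eps i = {lam n l1 lN eps i <..< lam n l1 lN eps (i+1)}"

definition I_closed :: "nat \<Rightarrow> real \<Rightarrow> real \<Rightarrow> real \<Rightarrow> nat \<Rightarrow> real set" where
  "I_closed n l1 lN eps i = {lam n l1 lN eps i .. lam n l1 lN eps (i+1)}"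

text \<open>Block form of \<open>f (l + z)\<close>, \<open>z < 0\<close> small, with respect to a decomposition into dimensions
  \<open>a\<close> and \<open>d\<close>: upper left block \<open>L + z O(1)\<close>, lower right block \<open>X / z + O(1)\<close>.\<close>

definition gluing ::
  "nat \<Rightarrow> nat \<Rightarrow> real \<Rightarrow> mat_fun \<Rightarrow> complex mat \<Rightarrow> complex mat \<Rightarrow> bool" where
  "gluing a d l f L X \<longleftrightarrow>
     (\<forall>r<a. \<forall>s<a. power_O l 1 (\<lambda>t. f t $$ (r,s) - L $$ (r,s))) \<and>
     (\<forall>r<a. \<forall>s<d. power_O l ((real d - 1) / 2) (\<lambda>t. f t $$ (r, a + s))) \<and>
     (\<forall>r<d. \<forall>s<a. power_O l ((real d - 1) / 2) (\<lambda>t. f t $$ (a + r, s))) \<and>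
     (\<forall>r<d. \<forall>s<d. power_O l 0
        (\<lambda>t. f t $$ (a + r, a + s) - X $$ (r,s) / of_real (t - l)))"

definition hurtubise_complex ::
  "nat \<Rightarrow> (nat \<Rightarrow> nat) \<Rightarrow> real \<Rightarrow> real \<Rightarrow> real \<Rightarrow> hurtubise_data \<Rightarrow> bool" where
  "hurtubise_complex n k l1 lN eps c \<longleftrightarrow>
     (let M = msize n k; m = M 1; \<Lambda> = lam n l1 lN eps;
          \<alpha> = (\<lambda>i. fst (fst c i)); \<beta> = (\<lambda>i. snd (fst c i)); v = snd c
      in (\<forall>i\<in>{1..n}. smooth_mat (M i) (I_open n l1 lN eps i) (\<alpha> i) \<and>
                     smooth_mat (M i) (I_open n l1 lN eps i) (\<beta> i) \<and>
                     complex_equation (I_open n l1 lN eps i) (M i) (\<alpha> i) (\<beta> i)) \<and>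
         simple_pole_right m l1 (\<alpha> 1) \<and> simple_pole_right m l1 (\<beta> 1) \<and>
         sim_conj m (residue_right m l1 (\<alpha> 1)) (residue_right m l1 (\<beta> 1)) (xmat m) (ymat m) \<and>
         v 1 \<in> carrier_vec m \<and> v 1 \<noteq> 0\<^sub>v m \<and>
         residue_right m l1 (\<alpha> 1) *\<^sub>v v 1 = (- (of_nat m - 1) / 4) \<cdot>\<^sub>v v 1 \<and>
         (\<forall>i\<in>{2..n}. analytic_right (M i) (\<Lambda> i) (\<alpha> i) \<and> analytic_right (M i) (\<Lambda> i) (\<beta> i)) \<and>
         (\<forall>i\<in>{1..n}. \<exists>X\<in>carrier_mat (k i) (k i). \<exists>Y\<in>carrier_mat (k i) (k i).
            sim_conj (k i) X Y (xmat (k i)) (ymat (k i)) \<and>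
            gluing (M (i+1)) (k i) (\<Lambda> (i+1)) (\<alpha> i)
              (value_right (M (i+1)) (\<Lambda> (i+1)) (\<alpha> (i+1))) X \<and>
            gluing (M (i+1)) (k i) (\<Lambda> (i+1)) (\<beta> i)
              (value_right (M (i+1)) (\<Lambda> (i+1)) (\<beta> (i+1))) Y \<and>
            (\<exists>w\<in>carrier_vec (k i). w \<noteq> 0\<^sub>v (k i) \<and> v (i+1) = 0\<^sub>v (M (i+1)) @\<^sub>v w \<and>
               X *\<^sub>v w = (- (of_nat (k i) - 1) / 4) \<cdot>\<^sub>v w)))"

definition hurtubise_rel ::
  "nat \<Rightarrow> (nat \<Rightarrow> nat) \<Rightarrow> real \<Rightarrow> real \<Rightarrow> real \<Rightarrow> (hurtubise_data \<times> hurtubise_data) set" where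
  "hurtubise_rel n k l1 lN eps = {(c, c').
     hurtubise_complex n k l1 lN eps c \<and> hurtubise_complex n k l1 lN eps c' \<and>
     (\<exists>g :: nat \<Rightarrow> mat_fun.
        (\<forall>i\<in>{1..n}.
           smooth_mat (msize n k i) (I_open n l1 lN eps i) (g i) \<and>
           (\<forall>t\<in>I_closed n l1 lN eps i. g i t \<in> GL (msize n k i)) \<and>
           (\<forall>r<msize n k i. \<forall>s<msize n k i.
              continuous_on (I_closed n l1 lN eps i) (\<lambda>t. g i t $$ (r,s))) \<and>
           (\<forall>t\<in>I_open n l1 lN eps i.
              fst (fst c' i) t = fst (gauge (g i) (fst c i)) t \<and>
              snd (fst c' i) t = snd (gauge (g i) (fst c i)) t) \<and>
           snd c' (i+1) = g i (lam n l1 lN eps (i+1)) *\<^sub>v snd c (i+1)) \<and>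
        (\<forall>i\<in>{1..<n}. \<exists>h\<in>GL (k i).
           g i (lam n l1 lN eps (i+1)) =
             diag_block_mat [g (i+1) (lam n l1 lN eps (i+1)), h]) \<and>
        snd c' 1 = g 1 l1 *\<^sub>v snd c 1)}"

definition N_H :: "nat \<Rightarrow> (nat \<Rightarrow> nat) \<Rightarrow> real \<Rightarrow> real \<Rightarrow> real \<Rightarrow> hurtubise_data set set" where
  "N_H n k l1 lN eps =
     {c. hurtubise_complex n k l1 lN eps c} // hurtubise_rel n k l1 lN eps"

section \<open>The slice of normal forms\<close>

definition M_k :: "nat \<Rightarrow> (nat \<Rightarrow> nat) \<Rightarrow> complex mat set" where
  "M_k n k = {B \<in> carrier_mat (msize n k 1) (msize n k 1).
     (\<forall>i\<in>{1..n}. \<forall>r<bsize n k i. \<forall>s. s + 1 < bsize n k i \<longrightarrow>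
        block n k B i i $$ (r,s) = (if r = s + 1 then 1 else 0)) \<and>
     (\<forall>i\<in>{1..n}. \<forall>j\<in>{1..n}. i < j \<longrightarrow> (\<forall>r<bsize n k i. \<forall>s. s + 1 < bsize n k j \<longrightarrow>
        block n k B i j $$ (r,s) = 0)) \<and>
     (\<forall>i\<in>{1..n}. \<forall>j\<in>{1..n}. i > j \<longrightarrow> (\<forall>r<bsize n k i. \<forall>s<bsize n k j.
        s + 1 < bsize n k j \<or> bsize n k j \<le> r \<longrightarrow> block n k B i j $$ (r,s) = 0))}"

text \<open>The normal form of \<open>\<beta> (\<lambda>\<^sub>1 + z)\<close>; the entry \<open>q\<^sub>i\<^sub>+\<^sub>1\<close> is \<open>q i\<close> because of the shift of indices.\<close>

definition beta_normal :: "nat \<Rightarrow> real \<Rightarrow> (nat \<Rightarrow> complex) \<Rightarrow> complex mat" where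
  "beta_normal m z q = mat m m (\<lambda>(i,j).
     if j = m - 1 then - (complex_of_real z ^ (m - 1 - i)) * q i
     else if i = j + 1 then 1 / complex_of_real z else 0)"

definition B_k :: "nat \<Rightarrow> (nat \<Rightarrow> nat) \<Rightarrow> real \<Rightarrow> real \<Rightarrow> real \<Rightarrow> nahm_pair set" where
  "B_k n k l1 lN eps = {(\<alpha>, \<beta>).
     smooth_mat (msize n k 1) {l1<..<lN} \<alpha> \<and> smooth_mat (msize n k 1) {l1<..<lN} \<beta> \<and>
     complex_equation {l1<..<lN} (msize n k 1) \<alpha> \<beta> \<and>
     (\<exists>q. \<forall>\<^sub>F t in at_right l1.
        \<alpha> t = of_real (- 1 / (t - l1)) \<cdot>\<^sub>m x1_mat n k \<and>
        \<beta> t = beta_normal (msize n k 1) (t - l1) q) \<and>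
     (\<exists>B\<in>M_k n k. \<forall>t\<in>{lN - real n * eps<..<lN}.
        \<alpha> t = of_real (1 / (t - lN)) \<cdot>\<^sub>m xN_mat n k \<and>
        \<beta> t = diag_powr (t - lN) ((-2) \<cdot>\<^sub>m xN_mat n k) * B *
              diag_powr (t - lN) (2 \<cdot>\<^sub>m xN_mat n k))}"

definition class_k ::
  "nat \<Rightarrow> (nat \<Rightarrow> nat) \<Rightarrow> real \<Rightarrow> real \<Rightarrow> nahm_pair \<Rightarrow> nahm_data set" where
  "class_k n k l1 lN b = k_nahm_rel n k l1 lN ``
     {(b, \<lambda>i. if i = 1 then unit_vec (msize n k 1) (msize n k 1 - 1)
              else unit_vec (msize n k 1) (msize n k i))}"

definition class_H ::
  "nat \<Rightarrow> (nat \<Rightarrow> nat) \<Rightarrow> real \<Rightarrow> real \<Rightarrow> real \<Rightarrow> (nat \<Rightarrow> nahm_pair) \<Rightarrow> hurtubise_data set" where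
  "class_H n k l1 lN eps b = hurtubise_rel n k l1 lN eps ``
     {(b, \<lambda>i. if i = 1 then unit_vec (msize n k 1) 0
              else unit_vec (msize n k (i - 1)) (msize n k i))}"

section \<open>The map \<open>\<Phi>\<close>\<close>

fun nu :: "(nat \<Rightarrow> complex) \<Rightarrow> (nat \<Rightarrow> complex) \<Rightarrow> nat \<Rightarrow> nat \<Rightarrow> complex" where
  "nu c d K r = c (K + 1 - r) + (\<Sum>s=1..<r. d (K + 1 - s) * nu c d K (r - s))"

text \<open>In \<open>nu\<close> the last columns \<open>c\<close>, \<open>d\<close> are indexed from 1.\<close>

definition gamma_factor ::
  "nat \<Rightarrow> (nat \<Rightarrow> nat) \<Rightarrow> nat \<Rightarrow> nat \<Rightarrow> complex mat \<Rightarrow> complex mat" where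
  "gamma_factor n k i j A =
     (let K = bsize n k j;
          c = (\<lambda>r. block n k A i j $$ (r - 1, K - 1));
          d = (\<lambda>r. block n k A j j $$ (r - 1, K - 1))
      in mat (msize n k 1) (msize n k 1) (\<lambda>(a,b).
           if a = b then 1
           else if boff n k i \<le> a \<and> a < boff n k i + bsize n k i \<and>
                   boff n k j \<le> b \<and> b < boff n k j + K \<and>
                   a - boff n k i < b - boff n k j
                then nu c d K ((b - boff n k j) - (a - boff n k i))
           else 0))"

definition gamma_mat :: "nat \<Rightarrow> (nat \<Rightarrow> nat) \<Rightarrow> complex mat \<Rightarrow> complex mat" where
  "gamma_mat n k B =
     fold (\<lambda>(i,j) G. gamma_factor n k i j (G * B * minv G) * G)
       (concat (map (\<lambda>i. map (\<lambda>j. (i,j)) [1..<i]) [2..<n+1]))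
       (1\<^sub>m (msize n k 1))"

definition is_g_reg ::
  "nat \<Rightarrow> (nat \<Rightarrow> nat) \<Rightarrow> real \<Rightarrow> real \<Rightarrow> real \<Rightarrow> mat_fun \<Rightarrow> bool" where
  "is_g_reg n k l1 lN eps g \<longleftrightarrow>
     smooth_mat (msize n k 1) {l1<..<lN} g \<and> (\<forall>t\<in>{l1<..<lN}. g t \<in> GL (msize n k 1)) \<and>
     (\<forall>\<^sub>F t in at_right l1. g t = diag_powr (t - l1) ((-2) \<cdot>\<^sub>m x1_mat n k)) \<and>
     (\<forall>t\<in>{lN - real n * eps<..<lN}. g t = diag_powr (t - lN) (2 \<cdot>\<^sub>m xN_mat n k))"

text \<open>Smooth curves \<open>s \<mapsto> c s\<close> in the (infinite-dimensional) space of normal forms: smoothness is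
  joint in the curve parameter and \<open>t\<close>, and the neighbourhood of \<open>\<lambda>\<^sub>1\<close> on which the normal form holds
  can be chosen locally uniformly in \<open>s\<close>, as it is for curves in a space of functions with prescribed
  germ at \<open>\<lambda>\<^sub>1\<close>.  Tangent vectors are the velocities of such curves.\<close>

definition B_k_curve ::
  "nat \<Rightarrow> (nat \<Rightarrow> nat) \<Rightarrow> real \<Rightarrow> real \<Rightarrow> real \<Rightarrow> (real \<Rightarrow> nahm_pair) \<Rightarrow> bool" where
  "B_k_curve n k l1 lN eps c \<longleftrightarrow>
     (\<forall>s. c s \<in> B_k n k l1 lN eps) \<and>
     smooth_mat (msize n k 1) (UNIV \<times> {l1<..<lN}) (\<lambda>(s,t). fst (c s) t) \<and>
     smooth_mat (msize n k 1) (UNIV \<times> {l1<..<lN}) (\<lambda>(s,t). snd (c s) t) \<and>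
     (\<exists>q. \<forall>s0. \<forall>\<^sub>F (s,t) in nhds s0 \<times>\<^sub>F at_right l1.
        fst (c s) t = of_real (- 1 / (t - l1)) \<cdot>\<^sub>m x1_mat n k \<and>
        snd (c s) t = beta_normal (msize n k 1) (t - l1) (q s))"

text \<open>The choice of \<open>g (\<alpha>, \<beta>)\<close> in the second step.  Its arguments are the pairs \<open>g\<^sub>r\<^sub>e\<^sub>g.b\<close>; smooth
  dependence means that smooth curves are mapped to smooth curves, in the sense above.\<close>

definition is_g_choice ::
  "nat \<Rightarrow> (nat \<Rightarrow> nat) \<Rightarrow> real \<Rightarrow> real \<Rightarrow> real \<Rightarrow> mat_fun \<Rightarrow> (nahm_pair \<Rightarrow> mat_fun) \<Rightarrow> bool" where
  "is_g_choice n k l1 lN eps g_reg g \<longleftrightarrow>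
     (\<forall>b\<in>B_k n k l1 lN eps.
        smooth_mat (msize n k 1) {l1<..<lN} (g (gauge g_reg b)) \<and>
        (\<forall>t\<in>{l1<..<lN}. g (gauge g_reg b) t \<in> GL (msize n k 1)) \<and>
        (\<forall>\<^sub>F t in at_right l1. g (gauge g_reg b) t = 1\<^sub>m (msize n k 1)) \<and>
        (\<forall>B\<in>M_k n k. (\<forall>t\<in>{lN - real n * eps<..<lN}. snd (gauge g_reg b) t = B) \<longrightarrow>
           (\<forall>t\<in>{lN - real n * eps<..<lN}. g (gauge g_reg b) t = gamma_mat n k B))) \<and>
     (\<forall>c. B_k_curve n k l1 lN eps c \<longrightarrow>
        smooth_mat (msize n k 1) (UNIV \<times> {l1<..<lN}) (\<lambda>(s,t). g (gauge g_reg (c s)) t) \<and>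
        (\<forall>s0. \<forall>\<^sub>F (s,t) in nhds s0 \<times>\<^sub>F at_right l1.
           g (gauge g_reg (c s)) t = 1\<^sub>m (msize n k 1)))"

definition is_g_H ::
  "nat \<Rightarrow> (nat \<Rightarrow> nat) \<Rightarrow> real \<Rightarrow> real \<Rightarrow> real \<Rightarrow> (nat \<Rightarrow> mat_fun) \<Rightarrow> bool" where
  "is_g_H n k l1 lN eps g \<longleftrightarrow>
     (\<forall>i\<in>{1..n}.
        smooth_mat (msize n k i) (I_open n l1 lN eps i) (g i) \<and>
        (\<forall>t\<in>I_open n l1 lN eps i. g i t \<in> GL (msize n k i)) \<and>
        (\<forall>\<^sub>F t in at_left (lam n l1 lN eps (i+1)).
           g i t = diag_block_mat [1\<^sub>m (msize n k (i+1)),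
                     diag_powr (t - lam n l1 lN eps (i+1)) ((-2) \<cdot>\<^sub>m xmat (k i))])) \<and>
     (\<forall>\<^sub>F t in at_right l1. g 1 t = diag_powr (t - l1) ((-2) \<cdot>\<^sub>m xmat (msize n k 1))) \<and>
     (\<forall>i\<in>{2..n}. \<forall>\<^sub>F t in at_right (lam n l1 lN eps i). g i t = 1\<^sub>m (msize n k i))"

definition upper_left :: "nat \<Rightarrow> complex mat \<Rightarrow> complex mat" where
  "upper_left l A = mat l l (\<lambda>(i,j). A $$ (i,j))"

definition Phi ::
  "nat \<Rightarrow> (nat \<Rightarrow> nat) \<Rightarrow> mat_fun \<Rightarrow> (nahm_pair \<Rightarrow> mat_fun) \<Rightarrow> (nat \<Rightarrow> mat_fun)
     \<Rightarrow> nahm_pair \<Rightarrow> (nat \<Rightarrow> nahm_pair)" where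
  "Phi n k g_reg g g_H b =
     (let p1 = gauge g_reg b;
          p2 = gauge (g p1) p1
      in (\<lambda>i. gauge (g_H i) ((\<lambda>t. upper_left (msize n k i) (fst p2 t)),
                             (\<lambda>t. upper_left (msize n k i) (snd p2 t)))))"

section \<open>The 2-forms\<close>

definition velocity :: "nat \<Rightarrow> (real \<Rightarrow> nahm_pair) \<Rightarrow> nahm_pair" where
  "velocity d c =
     ((\<lambda>t. mat d d (\<lambda>(i,j). vector_derivative (\<lambda>s. fst (c s) t $$ (i,j)) (at 0))),
      (\<lambda>t. mat d d (\<lambda>(i,j). vector_derivative (\<lambda>s. snd (c s) t $$ (i,j)) (at 0))))"

definition form_on :: "real \<Rightarrow> real \<Rightarrow> nahm_pair \<Rightarrow> nahm_pair \<Rightarrow> complex" where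
  "form_on t0 t1 X X' =
     integral {t0..t1} (\<lambda>t. mtrace (fst X t * snd X' t - fst X' t * snd X t))"

definition omega_B :: "real \<Rightarrow> real \<Rightarrow> nahm_pair \<Rightarrow> nahm_pair \<Rightarrow> complex" where
  "omega_B l1 lN X X' = form_on l1 lN X X'"

text \<open>The form on the image of \<open>\<Phi>\<close>, whose tangent vectors are tuples indexed by the intervals.\<close>

definition omega_H ::
  "nat \<Rightarrow> real \<Rightarrow> real \<Rightarrow> real \<Rightarrow> (nat \<Rightarrow> nahm_pair) \<Rightarrow> (nat \<Rightarrow> nahm_pair) \<Rightarrow> complex" where
  "omega_H n l1 lN eps X X' =
     (\<Sum>i=1..n. form_on (lam n l1 lN eps i) (lam n l1 lN eps (i+1)) (X i) (X' i))"

end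

theory Submission
  imports Defs
begin

text \<open>
  The map \<open>\<Phi>\<close> is made of gauge transformations and a truncation.  A gauge transformation that is the
  same for all points of \<open>\<B>\<^sub>k\<close> conjugates tangent vectors and so leaves \<open>Tr (a b' - a' b)\<close> alone; the
  content of the theorem is that neither the point-dependent second step nor the truncation changes
  the integral.

  On the first interval nothing is truncated, and the gauge transformations combine into a single
  one, \<open>K\<close>.  Along a curve of solutions \<open>K\<close> moves as well.  Put \<open>\<xi> = K\<^sup>-\<^sup>1 \<partial>\<^sub>sK\<close>; then the velocity
  \<open>(a, b)\<close> becomes, up to conjugation by \<open>K\<close>, the pair \<open>(a + [\<xi>, \<alpha>] - \<xi>'/2, b + [\<xi>, \<beta>])\<close>
  (\<open>gauge_velocity\<close>).  For a second curve through the same point, with \<open>\<eta>\<close> in place of \<open>\<xi>\<close>, the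
  complex equation and its linearization show that the integrand changes by the exact derivative
  \<open>1/2 d/dt (Tr (\<eta> b) - Tr (\<xi> b') - Tr ([\<xi>, \<eta>] \<beta>))\<close>
  (\<open>trace_form_gauge_variation\<close>, \<open>form_variation\<close>).  So only boundary values count.

  Near \<open>\<lambda>\<^sub>1\<close> the second gauge transformation is \<open>1\<close> for all points, hence \<open>\<xi> = \<eta> = 0\<close>.  Near the right
  end, after conjugation by the regularizing gauge transformation, \<open>\<xi>\<close> is \<open>\<gamma>\<^sup>-\<^sup>1 \<partial>\<^sub>s\<gamma>\<close> with
  \<open>\<gamma> = \<gamma>\<^sub>B\<close>, while \<open>\<beta>\<close> lies in the set \<open>\<MM>\<^sub>k\<close> of normal forms and \<open>b\<close>, \<open>b'\<close> are tangent to it.  The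
  sizes of the blocks do not decrease downwards, and for this reason every factor of \<open>\<gamma>\<^sub>B\<close> is the identity
  plus a matrix below the block diagonal with zero last row in each block
  (\<open>unipotent_gamma_factor\<close>).  These positions form a transitive relation, so \<open>\<xi>\<close>, \<open>\<eta>\<close> and
  \<open>[\<xi>, \<eta>]\<close> are supported on them.  Elements of \<open>\<MM>\<^sub>k\<close> vanish at the transposed positions, because
  above the block diagonal they have entries only in the last column of each block
  (\<open>M_k_vanishes\<close>).  Therefore the three traces are zero (\<open>boundary_term_vanishes\<close>).

  The other intervals lie in the part near \<open>\<lambda>\<^sub>N\<close> where \<open>\<alpha>\<close> is the fixed function \<open>x\<^sub>N/z\<close>.  The
  regularization turns it into \<open>0\<close>, and it stays \<open>0\<close> until the last step, so the \<open>\<alpha>\<close>-components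
  of all tangent vectors vanish there, both before \<open>\<Phi>\<close> and after, and so do both integrands.
\<close>

section \<open>The algebra of square matrices and the trace\<close>

lemma minv_GL:
  assumes "A \<in> GL d"
  shows "minv A \<in> carrier_mat d d" "A * minv A = 1\<^sub>m d" "minv A * A = 1\<^sub>m d"
proof -
  from assms obtain B where A: "A \<in> carrier_mat d d" and B: "inverts_mat A B" "inverts_mat B A"
    by (auto simp: GL_def invertible_mat_def)
  have Bc: "B' \<in> carrier_mat d d" if "inverts_mat A B'" "inverts_mat B' A" for B'
  proof (rule carrier_matI)
    have "dim_col (A * B') = d" "dim_col (B' * A) = dim_row B'"
      using that A by (simp_all only: inverts_mat_def index_one_mat carrier_matD)
    then show "dim_row B' = d" "dim_col B' = d" using A by simp_all
  qed
  have uniq: "B' = B" if B': "inverts_mat A B'" "inverts_mat B' A" for B'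
  proof -
    have c: "B \<in> carrier_mat d d" "B' \<in> carrier_mat d d" using Bc B B' by auto
    have e: "A * B = 1\<^sub>m d" "B' * A = 1\<^sub>m d" using A c B B' by (simp_all add: inverts_mat_def)
    have "B' = B' * (A * B)" using c unfolding e by simp
    also have "\<dots> = (B' * A) * B" using assoc_mult_mat[OF c(2) A c(1)] by simp
    also have "\<dots> = B" using c unfolding e by simp
    finally show ?thesis .
  qed
  have "minv A = B" unfolding minv_def using B uniq by (intro the_equality) blast+
  then show "minv A \<in> carrier_mat d d" "A * minv A = 1\<^sub>m d" "minv A * A = 1\<^sub>m d"
    using B Bc[OF B] A by (auto simp: inverts_mat_def)
qed

lemma GL_carrier: "A \<in> GL d \<Longrightarrow> A \<in> carrier_mat d d"
  by (simp add: GL_def)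

lemma GL_inverseI:
  assumes "A \<in> carrier_mat d d" "B \<in> carrier_mat d d" "A * B = 1\<^sub>m d" "B * A = 1\<^sub>m d"
  shows "A \<in> GL d" "minv A = B"
proof -
  show g: "A \<in> GL d" using assms by (auto simp: GL_def invertible_mat_def inverts_mat_def)
  have "minv A = minv A * (A * B)" unfolding assms(3) using minv_GL(1)[OF g] by simp
  also have "\<dots> = (minv A * A) * B" using assoc_mult_mat[OF minv_GL(1)[OF g] assms(1,2)] by simp
  also have "\<dots> = B" unfolding minv_GL(3)[OF g] using assms(2) by simp
  finally show "minv A = B" .
qed

text \<open>The laws for matrices of one fixed square size have no free intermediate dimensions, so that the
  simplifier can discharge their side conditions.\<close>

lemma sq_carrier:
  fixes A B :: "complex mat"
  shows "A \<in> carrier_mat d d \<Longrightarrow> B \<in> carrier_mat d d \<Longrightarrow> A * B \<in> carrier_mat d d"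
    "A \<in> carrier_mat d d \<Longrightarrow> B \<in> carrier_mat d d \<Longrightarrow> A + B \<in> carrier_mat d d"
    "A \<in> carrier_mat d d \<Longrightarrow> B \<in> carrier_mat d d \<Longrightarrow> A - B \<in> carrier_mat d d"
    "A \<in> carrier_mat d d \<Longrightarrow> c \<cdot>\<^sub>m A \<in> carrier_mat d d"
  by auto

lemma sq_distrib:
  fixes A B C :: "complex mat"
  assumes "A \<in> carrier_mat d d" "B \<in> carrier_mat d d" "C \<in> carrier_mat d d"
  shows "A * B * C = A * (B * C)" "(A + B) * C = A * C + B * C" "A * (B + C) = A * B + A * C"
    "(A - B) * C = A * C - B * C" "A * (B - C) = A * B - A * C"
  using assms by (auto simp: add_mult_distrib_mat[of _ d d] minus_mult_distrib_mat[of _ d d]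
      mult_add_distrib_mat[of _ d d _ d] mult_minus_distrib_mat[of _ d d _ d] assoc_mult_mat[of _ d d _ d _ d])

lemma sq_smult:
  fixes A B :: "complex mat"
  assumes "A \<in> carrier_mat d d" "B \<in> carrier_mat d d"
  shows "(c \<cdot>\<^sub>m A) * B = c \<cdot>\<^sub>m (A * B)" "A * (c \<cdot>\<^sub>m B) = c \<cdot>\<^sub>m (A * B)"
  using assms by (auto simp: mult_smult_assoc_mat[of _ d d _ d] mult_smult_distrib[of _ d d _ d])

lemma index_mult_sum:
  fixes A B :: "complex mat"
  assumes "A \<in> carrier_mat d d" "B \<in> carrier_mat d d" "i < d" "j < d"
  shows "(A * B) $$ (i,j) = (\<Sum>l<d. A $$ (i,l) * B $$ (l,j))"
  using assms by (auto simp: scalar_prod_def lessThan_atLeast0 intro!: sum.cong)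

lemma inverse_cancel:
  fixes K H X :: "complex mat"
  assumes "K \<in> carrier_mat d d" "H \<in> carrier_mat d d" "K * H = 1\<^sub>m d" "H * K = 1\<^sub>m d" "X \<in> carrier_mat d d"
  shows "K * (H * X) = X" "H * (K * X) = X"
  using assms assoc_mult_mat[of K d d H d X d] assoc_mult_mat[of H d d K d X d] by auto

lemma mtrace_linear:
  assumes "A \<in> carrier_mat d d" "B \<in> carrier_mat d d"
  shows "mtrace (A + B) = mtrace A + mtrace B" "mtrace (A - B) = mtrace A - mtrace B"
  using assms by (auto simp: mtrace_def sum.distrib sum_subtractf)

lemma mtrace_smult: "A \<in> carrier_mat d d \<Longrightarrow> mtrace (c \<cdot>\<^sub>m A) = c * mtrace A"
  by (auto simp: mtrace_def sum_distrib_left)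

lemma mtrace_mult:
  assumes "A \<in> carrier_mat d d" "B \<in> carrier_mat d d"
  shows "mtrace (A * B) = (\<Sum>i<d. \<Sum>j<d. A $$ (i,j) * B $$ (j,i))"
  using assms by (auto simp: mtrace_def scalar_prod_def lessThan_atLeast0 intro!: sum.cong)

lemma mtrace_commute:
  assumes "A \<in> carrier_mat d d" "B \<in> carrier_mat d d"
  shows "mtrace (A * B) = mtrace (B * A)"
  unfolding mtrace_mult[OF assms] mtrace_mult[OF assms(2,1)]
  by (subst sum.swap) (simp add: mult.commute)

lemma mtrace_rotate:
  assumes "A \<in> carrier_mat d d" "B \<in> carrier_mat d d" "C \<in> carrier_mat d d"
  shows "mtrace (A * (B * C)) = mtrace (B * (C * A))"
  using mtrace_commute[of A d "B * C"] assms by (simp add: sq_distrib[of _ d])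

lemma mtrace_rotate4:
  assumes "A \<in> carrier_mat d d" "B \<in> carrier_mat d d" "C \<in> carrier_mat d d" "D \<in> carrier_mat d d"
  shows "mtrace (A * (B * (C * D))) = mtrace (B * (C * (D * A)))"
  using mtrace_commute[of A d "B * (C * D)"] assms by (simp add: sq_distrib[of _ d] sq_carrier)

lemma mtrace_conj:
  assumes K: "K \<in> carrier_mat d d" "H \<in> carrier_mat d d" "H * K = 1\<^sub>m d"
    and X: "X \<in> carrier_mat d d" "Y \<in> carrier_mat d d"
  shows "mtrace ((K * X * H) * (K * Y * H)) = mtrace (X * Y)"
proof -
  have "(K * X * H) * (K * Y * H) = K * X * (H * K) * Y * H"
    using K(1,2) X by (simp add: sq_distrib[of _ d] sq_carrier)
  also have "\<dots> = K * (X * Y * H)" using assms by (simp add: sq_distrib[of _ d] sq_carrier)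
  finally have "mtrace ((K * X * H) * (K * Y * H)) = mtrace ((X * Y * H) * K)"
    using mtrace_commute[of K d "X * Y * H"] K(1,2) X by (simp add: sq_carrier)
  also have "(X * Y * H) * K = X * Y * (H * K)"
    using X K(1,2) by (simp add: sq_distrib[of _ d] sq_carrier)
  finally show ?thesis using X K by (simp add: sq_carrier)
qed

text \<open>Since \<open>Tr\<close> is invariant, the left-hand side is \<open>Tr (y ([be, a] + [b, al])) + Tr (yd b)/2\<close>, and
  \<open>bd\<close> is twice the sum of brackets.\<close>

lemma trace_variation_linear:
  fixes a b al be y yd bd :: "complex mat"
  assumes c: "a \<in> carrier_mat d d" "b \<in> carrier_mat d d"
      "al \<in> carrier_mat d d" "be \<in> carrier_mat d d" "y \<in> carrier_mat d d" "yd \<in> carrier_mat d d"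
    and bd: "bd = 2 \<cdot>\<^sub>m (be * a - a * be) + 2 \<cdot>\<^sub>m (b * al - al * b)"
  shows "mtrace (a * (y * be - be * y)) - mtrace ((y * al - al * y - (1/2) \<cdot>\<^sub>m yd) * b)
       = (1/2) * mtrace (yd * b + y * bd)"
  unfolding bd
  by (simp only: c sq_distrib[of _ d] sq_smult[of _ d] sq_carrier mtrace_linear[of _ d] mtrace_smult[of _ d]
      mtrace_rotate[of a d y be] mtrace_rotate[of a d be y] mtrace_rotate[of be d y a]
      mtrace_rotate[of al d y b])
    (simp add: algebra_simps)

text \<open>By the Jacobi identity the terms with \<open>al\<close> add up to \<open>Tr ([x, y] [al, be])\<close>, and \<open>[al, be]\<close> is
  \<open>- bed/2\<close>; the terms with \<open>xd\<close> and \<open>yd\<close> add up to \<open>- Tr ([xd, y] be + [x, yd] be)/2\<close>.\<close>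

lemma trace_variation_quadratic:
  fixes al be x y xd yd bed :: "complex mat"
  assumes c: "al \<in> carrier_mat d d" "be \<in> carrier_mat d d" "x \<in> carrier_mat d d"
      "y \<in> carrier_mat d d" "xd \<in> carrier_mat d d" "yd \<in> carrier_mat d d"
    and bed: "bed = 2 \<cdot>\<^sub>m (be * al - al * be)"
  shows "mtrace ((x * al - al * x - (1/2) \<cdot>\<^sub>m xd) * (y * be - be * y))
         - mtrace ((y * al - al * y - (1/2) \<cdot>\<^sub>m yd) * (x * be - be * x))
       = - (1/2) * mtrace (((xd * y + x * yd) - (yd * x + y * xd)) * be + (x * y - y * x) * bed)"
  unfolding bed
  by (simp only: c sq_distrib[of _ d] sq_smult[of _ d] sq_carrier mtrace_linear[of _ d] mtrace_smult[of _ d]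
      mtrace_rotate4[of y d x al be, symmetric] mtrace_rotate4[of y d al x be, symmetric]
      mtrace_rotate4[of x d y al be, symmetric] mtrace_rotate4[of x d al y be, symmetric]
      mtrace_rotate4[of al d x y be, symmetric] mtrace_rotate4[of al d y x be, symmetric]
      mtrace_rotate[of y d xd be, symmetric] mtrace_rotate[of x d yd be, symmetric])
    (simp add: algebra_simps)

text \<open>The algebra behind the invariance of the form.  If \<open>xd\<close>, \<open>yd\<close> are the derivatives of \<open>x\<close>, \<open>y\<close>, and
  if \<open>bd\<close>, \<open>bd'\<close>, \<open>bed\<close> are the derivatives of \<open>b\<close>, \<open>b'\<close>, \<open>be\<close> prescribed by the complex equation and
  its linearization, then the added term is half the derivative of
  \<open>Tr (y b) - Tr (x b') - Tr ([x, y] be)\<close>.\<close>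

lemma trace_form_gauge_variation:
  fixes a b a' b' al be x y xd yd bd bd' bed :: "complex mat"
  assumes c: "a \<in> carrier_mat d d" "b \<in> carrier_mat d d" "a' \<in> carrier_mat d d" "b' \<in> carrier_mat d d"
      "al \<in> carrier_mat d d" "be \<in> carrier_mat d d" "x \<in> carrier_mat d d" "y \<in> carrier_mat d d"
      "xd \<in> carrier_mat d d" "yd \<in> carrier_mat d d"
    and bd: "bd = 2 \<cdot>\<^sub>m (be * a - a * be) + 2 \<cdot>\<^sub>m (b * al - al * b)"
    and bd': "bd' = 2 \<cdot>\<^sub>m (be * a' - a' * be) + 2 \<cdot>\<^sub>m (b' * al - al * b')"
    and bed: "bed = 2 \<cdot>\<^sub>m (be * al - al * be)"
  shows "mtrace ((a + (x * al - al * x) - (1/2) \<cdot>\<^sub>m xd) * (b' + (y * be - be * y))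
           - (a' + (y * al - al * y) - (1/2) \<cdot>\<^sub>m yd) * (b + (x * be - be * x)))
       = mtrace (a * b' - a' * b)
         + (1/2) * (mtrace (yd * b + y * bd) - mtrace (xd * b' + x * bd')
                   - mtrace (((xd * y + x * yd) - (yd * x + y * xd)) * be + (x * y - y * x) * bed))"
proof -
  let ?P = "x * al - al * x - (1/2) \<cdot>\<^sub>m xd" and ?P' = "y * al - al * y - (1/2) \<cdot>\<^sub>m yd"
  let ?Q = "x * be - be * x" and ?Q' = "y * be - be * y"
  have PQ: "?P \<in> carrier_mat d d" "?P' \<in> carrier_mat d d" "?Q \<in> carrier_mat d d" "?Q' \<in> carrier_mat d d"
    using c by (auto simp: sq_carrier)
  have expand: "mtrace ((u + p) * (v + q) - (u' + p') * (v' + q'))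
      = mtrace (u * v - u' * v') + (mtrace (u * q) - mtrace (p' * v'))
        - (mtrace (u' * q') - mtrace (p * v)) + (mtrace (p * q) - mtrace (p' * q'))"
    if "u \<in> carrier_mat d d" "p \<in> carrier_mat d d" "v \<in> carrier_mat d d" "q \<in> carrier_mat d d"
      "u' \<in> carrier_mat d d" "p' \<in> carrier_mat d d" "v' \<in> carrier_mat d d" "q' \<in> carrier_mat d d"
    for u p v q u' p' v' q'
    using that by (simp only: sq_distrib[of _ d] sq_carrier mtrace_linear[of _ d]) (simp add: algebra_simps)
  have assoc: "a + (x * al - al * x) - (1/2) \<cdot>\<^sub>m xd = a + ?P"
     "a' + (y * al - al * y) - (1/2) \<cdot>\<^sub>m yd = a' + ?P'"
    using c by (auto intro!: eq_matI)
  have combine: "p = q + u - v + w \<Longrightarrow> u = h * A \<Longrightarrow> v = h * B \<Longrightarrow> w = - h * C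
      \<Longrightarrow> p = q + h * (A - B - C)" for p q u v w h A B C :: complex
    by (simp add: algebra_simps)
  show ?thesis
    unfolding assoc
    by (rule combine[OF expand[OF c(1) PQ(1) c(4) PQ(4) c(3) PQ(2) c(2) PQ(3)]
      trace_variation_linear[OF c(1,2,5,6,8,10) bd] trace_variation_linear[OF c(3,4,5,6,7,9) bd']
      trace_variation_quadratic[OF c(5,6,7,8,9,10) bed]])
qed

section \<open>Derivatives of matrix-valued functions\<close>

text \<open>Values in the carrier are required only near \<open>u\<close>, since the functions of interest are controlled
  only on open intervals.\<close>

definition mat_has_deriv :: "nat \<Rightarrow> mat_fun \<Rightarrow> complex mat \<Rightarrow> real \<Rightarrow> bool" where
  "mat_has_deriv d f f' u \<longleftrightarrow> (\<forall>\<^sub>F x in nhds u. f x \<in> carrier_mat d d) \<and> f' \<in> carrier_mat d d \<and>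
     (\<forall>i<d. \<forall>j<d. ((\<lambda>x. f x $$ (i,j)) has_vector_derivative f' $$ (i,j)) (at u))"

lemma mat_has_derivD:
  assumes "mat_has_deriv d f f' u"
  shows "\<forall>\<^sub>F x in nhds u. f x \<in> carrier_mat d d" "f u \<in> carrier_mat d d" "f' \<in> carrier_mat d d"
    "i < d \<Longrightarrow> j < d \<Longrightarrow> ((\<lambda>x. f x $$ (i,j)) has_vector_derivative f' $$ (i,j)) (at u)"
  using assms eventually_nhds_x_imp_x[of _ u] by (auto simp: mat_has_deriv_def)

lemma mat_has_deriv_transform:
  assumes f: "mat_has_deriv d f f' u" and eq: "\<forall>\<^sub>F x in nhds u. f x = g x"
  shows "mat_has_deriv d g f' u"
proof -
  have "\<forall>\<^sub>F x in nhds u. g x \<in> carrier_mat d d"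
    using mat_has_derivD(1)[OF f] eq by eventually_elim simp
  moreover have "((\<lambda>x. g x $$ (i,j)) has_vector_derivative f' $$ (i,j)) (at u)" if "i < d" "j < d" for i j
  proof -
    from eq obtain T where T: "open T" "u \<in> T" "\<And>x. x \<in> T \<Longrightarrow> f x = g x"
      by (auto simp: eventually_nhds)
    show ?thesis
      by (rule has_vector_derivative_transform_within_open[OF mat_has_derivD(4)[OF f that] T(1,2)])
         (simp add: T(3))
  qed
  ultimately show ?thesis using mat_has_derivD(3)[OF f] by (simp add: mat_has_deriv_def)
qed

lemma mat_has_deriv_unique:
  assumes "mat_has_deriv d f f' u" "mat_has_deriv d f f'' u"
  shows "f' = f''"
proof (rule eq_matI)
  fix i j assume "i < dim_row f''" "j < dim_col f''"
  then have "i < d" "j < d" using mat_has_derivD(3)[OF assms(2)] by auto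
  then show "f' $$ (i,j) = f'' $$ (i,j)"
    using vector_derivative_unique_at mat_has_derivD(4)[OF assms(1)] mat_has_derivD(4)[OF assms(2)] by blast
qed (use mat_has_derivD(3)[OF assms(1)] mat_has_derivD(3)[OF assms(2)] in auto)

lemma mat_deriv_eq:
  assumes "mat_has_deriv d f f' u"
  shows "mat_deriv f u = f'"
  using mat_has_derivD[OF assms]
  by (auto simp: mat_deriv_def intro!: eq_matI vector_derivative_at)

lemma mat_vector_derivative_eq:
  assumes "mat_has_deriv d f f' u"
  shows "mat d d (\<lambda>(i,j). vector_derivative (\<lambda>s. f s $$ (i,j)) (at u)) = f'"
  using mat_has_derivD[OF assms]
  by (auto intro!: eq_matI vector_derivative_at)

lemma mat_has_deriv_const:
  "A \<in> carrier_mat d d \<Longrightarrow> mat_has_deriv d (\<lambda>x. A) (0\<^sub>m d d) u"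
  by (simp add: mat_has_deriv_def)

lemma mat_has_deriv_add:
  assumes f: "mat_has_deriv d f f' u" and g: "mat_has_deriv d g g' u"
  shows "mat_has_deriv d (\<lambda>x. f x + g x) (f' + g') u"
proof -
  define P where "P = (\<lambda>x. mat d d (\<lambda>(i,j). f x $$ (i,j) + g x $$ (i,j)))"
  have "mat_has_deriv d P (f' + g') u"
    using carrier_matD[OF mat_has_derivD(3)[OF f]] carrier_matD[OF mat_has_derivD(3)[OF g]]
    by (auto simp: mat_has_deriv_def P_def
        intro!: has_vector_derivative_add mat_has_derivD(4)[OF f] mat_has_derivD(4)[OF g])
  moreover have "\<forall>\<^sub>F x in nhds u. P x = f x + g x"
    using mat_has_derivD(1)[OF f] mat_has_derivD(1)[OF g]
    by eventually_elim (auto simp: P_def intro!: eq_matI)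
  ultimately show ?thesis by (rule mat_has_deriv_transform)
qed

lemma mat_has_deriv_smult:
  assumes f: "mat_has_deriv d f f' u"
  shows "mat_has_deriv d (\<lambda>x. c \<cdot>\<^sub>m f x) (c \<cdot>\<^sub>m f') u"
proof -
  define P where "P = (\<lambda>x. mat d d (\<lambda>(i,j). c * f x $$ (i,j)))"
  have "mat_has_deriv d P (c \<cdot>\<^sub>m f') u"
    using carrier_matD[OF mat_has_derivD(3)[OF f]]
    by (auto simp: mat_has_deriv_def P_def
        intro!: has_vector_derivative_mult_right mat_has_derivD(4)[OF f])
  moreover have "\<forall>\<^sub>F x in nhds u. P x = c \<cdot>\<^sub>m f x"
    using mat_has_derivD(1)[OF f]
    by eventually_elim (auto simp: P_def intro!: eq_matI)
  ultimately show ?thesis by (rule mat_has_deriv_transform)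
qed

lemma mat_has_deriv_diff:
  assumes f: "mat_has_deriv d f f' u" and g: "mat_has_deriv d g g' u"
  shows "mat_has_deriv d (\<lambda>x. f x - g x) (f' - g') u"
proof -
  have eq: "A - B = A + (-1) \<cdot>\<^sub>m B" if "A \<in> carrier_mat d d" "B \<in> carrier_mat d d" for A B :: "complex mat"
    using that by (auto intro!: eq_matI)
  have "mat_has_deriv d (\<lambda>x. f x + (-1) \<cdot>\<^sub>m g x) (f' - g') u"
    unfolding eq[OF mat_has_derivD(3)[OF f] mat_has_derivD(3)[OF g]]
    by (intro mat_has_deriv_add mat_has_deriv_smult f g)
  moreover have "\<forall>\<^sub>F x in nhds u. f x + (-1) \<cdot>\<^sub>m g x = f x - g x"
    using mat_has_derivD(1)[OF f] mat_has_derivD(1)[OF g] by eventually_elim (simp only: eq)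
  ultimately show ?thesis by (rule mat_has_deriv_transform)
qed

lemma mat_has_deriv_mult:
  assumes f: "mat_has_deriv d f f' u" and g: "mat_has_deriv d g g' u"
  shows "mat_has_deriv d (\<lambda>x. f x * g x) (f' * g u + f u * g') u"
proof -
  note c = mat_has_derivD(2,3)[OF f] mat_has_derivD(2,3)[OF g]
  define P where "P = (\<lambda>x. mat d d (\<lambda>(i,j). \<Sum>l<d. f x $$ (i,l) * g x $$ (l,j)))"
  have e: "(f' * g u + f u * g') $$ (i,j)
      = (\<Sum>l<d. f u $$ (i,l) * g' $$ (l,j) + f' $$ (i,l) * g u $$ (l,j))" if "i < d" "j < d" for i j
    using c that by (subst index_add_mat)
      (auto simp: index_mult_sum[of _ d] sum.distrib simp del: index_mult_mat(1))
  have "mat_has_deriv d P (f' * g u + f u * g') u"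
    unfolding mat_has_deriv_def
  proof (intro conjI allI impI)
    fix i j assume ij: "i < d" "j < d"
    have "((\<lambda>x. \<Sum>l<d. f x $$ (i,l) * g x $$ (l,j)) has_vector_derivative
       (\<Sum>l<d. f u $$ (i,l) * g' $$ (l,j) + f' $$ (i,l) * g u $$ (l,j))) (at u)"
      by (intro has_vector_derivative_sum has_vector_derivative_mult
          mat_has_derivD(4)[OF f] mat_has_derivD(4)[OF g]) (use ij in auto)
    then show "((\<lambda>x. P x $$ (i,j)) has_vector_derivative (f' * g u + f u * g') $$ (i,j)) (at u)"
      unfolding e[OF ij] using ij by (simp add: P_def)
  qed (use c in \<open>auto simp: P_def\<close>)
  moreover have "\<forall>\<^sub>F x in nhds u. P x = f x * g x"
    using mat_has_derivD(1)[OF f] mat_has_derivD(1)[OF g]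
  proof eventually_elim
    case (elim x)
    then show ?case
      by (intro eq_matI) (auto simp: P_def index_mult_sum[of _ d] simp del: index_mult_mat(1))
  qed
  ultimately show ?thesis by (rule mat_has_deriv_transform)
qed

lemma mtrace_has_vector_derivative:
  assumes f: "mat_has_deriv d f f' u"
  shows "((\<lambda>x. mtrace (f x)) has_vector_derivative mtrace f') (at u)"
proof -
  have "((\<lambda>x. \<Sum>i<d. f x $$ (i,i)) has_vector_derivative (\<Sum>i<d. f' $$ (i,i))) (at u)"
    by (intro has_vector_derivative_sum mat_has_derivD(4)[OF f]) auto
  moreover from mat_has_derivD(1)[OF f] obtain T where "open T" "u \<in> T" "\<And>x. x \<in> T \<Longrightarrow> f x \<in> carrier_mat d d"
    by (auto simp: eventually_nhds)
  ultimately show ?thesis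
    using mat_has_derivD(3)[OF f]
    by (auto simp: mtrace_def intro: has_vector_derivative_transform_within_open)
qed

lemma det_differentiable:
  fixes M :: "real \<Rightarrow> complex mat"
  assumes "\<And>x. M x \<in> carrier_mat d d"
    and "\<And>i j. i < d \<Longrightarrow> j < d \<Longrightarrow> (\<lambda>x. M x $$ (i,j)) differentiable (at u)"
  shows "(\<lambda>x. det (M x)) differentiable (at u)"
proof -
  have prod: "(\<lambda>x. \<Prod>i\<in>I. h i x) differentiable (at u)"
    if "finite I" "\<And>i. i \<in> I \<Longrightarrow> h i differentiable (at u)" for I :: "nat set" and h :: "nat \<Rightarrow> real \<Rightarrow> complex"
    using that by (induction I rule: finite_induct) auto
  have "(\<lambda>x. \<Prod>i = 0..<d. M x $$ (i, p i)) differentiable (at u)" if "p permutes {0..<d}" for p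
    by (rule prod[where h = "\<lambda>i x. M x $$ (i, p i)"])
       (use permutes_in_image[OF that] assms(2) in auto)
  then show ?thesis
    unfolding det_def'[OF assms(1)]
    by (intro differentiable_sum differentiable_mult differentiable_const)
       (auto simp: finite_permutations)
qed

text \<open>Cramer's rule shows that the entries of the inverse are rational functions of those of \<open>A\<close>.\<close>

lemma minv_eq_adj:
  assumes "A \<in> GL d"
  shows "minv A = (1 / det A) \<cdot>\<^sub>m adj_mat A" "det A \<noteq> 0"
proof -
  note A = GL_carrier[OF assms] and adj = adj_mat[OF GL_carrier[OF assms]]
  have "det A * det (minv A) = 1"
    using det_mult[OF A minv_GL(1)[OF assms]] minv_GL(2)[OF assms] by simp
  then show nz: "det A \<noteq> 0" by auto
  have c: "(1 / det A) \<cdot>\<^sub>m adj_mat A \<in> carrier_mat d d" using adj(1) by simp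
  show "minv A = (1 / det A) \<cdot>\<^sub>m adj_mat A"
    by (rule GL_inverseI(2)[OF A c]) (use nz in \<open>auto simp: sq_smult[OF A adj(1)] sq_smult[OF adj(1) A] adj\<close>)
qed

text \<open>Differentiability comes from Cramer's rule; the value of the derivative is then forced by
  differentiating \<open>f x * minv (f x) = 1\<close>.\<close>

lemma mat_has_deriv_minv:
  assumes f: "mat_has_deriv d f f' u" and GL: "\<forall>\<^sub>F x in nhds u. f x \<in> GL d"
  shows "mat_has_deriv d (\<lambda>x. minv (f x)) ((-1) \<cdot>\<^sub>m (minv (f u) * f' * minv (f u))) u"
proof -
  define F where "F = (\<lambda>x. mat d d (\<lambda>(i,j). f x $$ (i,j)))"
  have F: "F x \<in> carrier_mat d d" for x by (simp add: F_def)
  have Fd: "(\<lambda>x. F x $$ (i,j)) differentiable (at u)" if "i < d" "j < d" for i j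
    using that mat_has_derivD(4)[OF f that] by (auto simp: F_def differentiableI_vector)
  define H where "H = (\<lambda>x. (1 / det (F x)) \<cdot>\<^sub>m adj_mat (F x))"
  have Hc: "H x \<in> carrier_mat d d" for x using adj_mat(1)[OF F] by (simp add: H_def)
  have ev: "\<forall>\<^sub>F x in nhds u. f x = F x"
    using mat_has_derivD(1)[OF f] by eventually_elim (auto simp: F_def intro!: eq_matI)
  have eqH: "\<forall>\<^sub>F x in nhds u. H x = minv (f x)"
    using ev GL by eventually_elim (simp add: H_def minv_eq_adj)
  have u: "f u \<in> GL d" "f u = F u" using GL ev eventually_nhds_x_imp_x by blast+
  have "(\<lambda>x. H x $$ (i,j)) differentiable (at u)" if ij: "i < d" "j < d" for i j
  proof -
    have "(\<lambda>x. det (mat_delete (F x) j i)) differentiable (at u)"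
      by (rule det_differentiable[where d = "d - 1"])
         (use ij F in \<open>auto simp: mat_delete_def F_def[symmetric] carrier_matD[OF F] intro!: Fd\<close>)
    moreover have "(\<lambda>x. det (F x)) differentiable (at u)"
      by (rule det_differentiable[OF F Fd])
    moreover have "det (F u) \<noteq> 0" using minv_eq_adj(2)[OF u(1)] u(2) by simp
    moreover have "(\<lambda>x. H x $$ (i,j)) = (\<lambda>x. 1 / det (F x) * ((-1)^(j+i) * det (mat_delete (F x) j i)))"
      using ij carrier_matD[OF F] carrier_matD[OF adj_mat(1)[OF F]]
      by (auto simp: H_def adj_mat_def cofactor_def)
    ultimately show ?thesis by (auto intro!: differentiable_mult differentiable_divide)
  qed
  then have "((\<lambda>x. H x $$ (i,j)) has_vector_derivative vector_derivative (\<lambda>x. H x $$ (i,j)) (at u)) (at u)"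
    if "i < d" "j < d" for i j using that vector_derivative_works by blast
  then have "\<exists>H'. mat_has_deriv d H H' u"
    by (intro exI[of _ "mat d d (\<lambda>(i,j). vector_derivative (\<lambda>x. H x $$ (i,j)) (at u))"])
       (auto simp: mat_has_deriv_def Hc)
  then obtain H' where H': "mat_has_deriv d (\<lambda>x. minv (f x)) H' u"
    using mat_has_deriv_transform[OF _ eqH] by blast
  note c = mat_has_derivD(2,3)[OF f] mat_has_derivD(2,3)[OF H']
  have "mat_has_deriv d (\<lambda>x. f x * minv (f x)) (f' * minv (f u) + f u * H') u"
    by (rule mat_has_deriv_mult[OF f H'])
  moreover have "mat_has_deriv d (\<lambda>x. f x * minv (f x)) (0\<^sub>m d d) u"
    by (rule mat_has_deriv_transform[OF mat_has_deriv_const[OF one_carrier_mat]])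
       (use GL in eventually_elim, simp add: minv_GL)
  ultimately have z: "f' * minv (f u) + f u * H' = 0\<^sub>m d d" by (rule mat_has_deriv_unique)
  have "0\<^sub>m d d = minv (f u) * (f' * minv (f u) + f u * H')" unfolding z using c by simp
  also have "\<dots> = minv (f u) * f' * minv (f u) + (minv (f u) * f u) * H'"
    using c by (simp only: sq_distrib[of _ d] sq_carrier)
  also have "\<dots> = minv (f u) * f' * minv (f u) + H'" using c minv_GL(3)[OF u(1)] by simp
  finally have e: "0\<^sub>m d d = minv (f u) * f' * minv (f u) + H'" .
  have "H' = (-1) \<cdot>\<^sub>m (minv (f u) * f' * minv (f u))"
  proof (rule eq_matI)
    let ?X = "minv (f u) * f' * minv (f u)"
    have X: "?X \<in> carrier_mat d d" using c by simp
    fix i j assume "i < dim_row ((-1) \<cdot>\<^sub>m ?X)" "j < dim_col ((-1) \<cdot>\<^sub>m ?X)"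
    then have ij: "i < d" "j < d" using carrier_matD[OF X] by (simp_all only: index_smult_mat)
    have "(0\<^sub>m d d :: complex mat) $$ (i,j) = ?X $$ (i,j) + H' $$ (i,j)"
      unfolding e using ij carrier_matD[OF c(4)] by (simp only: index_add_mat)
    then show "H' $$ (i,j) = ((-1) \<cdot>\<^sub>m ?X) $$ (i,j)"
      using ij carrier_matD[OF X] by (simp add: eq_neg_iff_add_eq_0 add.commute del: index_mult_mat)
  qed (use c in auto)
  then show ?thesis using H' by simp
qed

section \<open>Smooth functions of two real variables\<close>

abbreviation fderiv :: "(real \<times> real \<Rightarrow> complex) \<Rightarrow> real \<times> real \<Rightarrow> real \<times> real \<Rightarrow> complex" where
  "fderiv f w \<equiv> (\<lambda>x. frechet_derivative f (at x) w)"

lemma smooth_on_fderiv: "smooth_on S f \<Longrightarrow> smooth_on S (fderiv f w)"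
  unfolding smooth_on_def by (metis C_diff_on.simps(2))

lemma smooth_on_continuous: "smooth_on S f \<Longrightarrow> continuous_on S f"
  unfolding smooth_on_def by (metis C_diff_on.simps(1))

lemma smooth_on_has_derivative:
  assumes "smooth_on S f" "x \<in> S"
  shows "(f has_derivative frechet_derivative f (at x)) (at x)"
  using assms unfolding smooth_on_def by (metis C_diff_on.simps(2) frechet_derivative_works)

lemma smooth_on_differentiable:
  fixes f :: "real \<Rightarrow> complex"
  assumes "smooth_on S f" "x \<in> S"
  shows "(f has_vector_derivative vector_derivative f (at x)) (at x)"
  using assms unfolding smooth_on_def by (metis C_diff_on.simps(2) vector_derivative_works)

lemma smooth_on_partial_derivatives:
  fixes f :: "real \<times> real \<Rightarrow> complex"
  assumes f: "smooth_on S f" and S: "(s,t) \<in> S"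
  shows "((\<lambda>s. f (s,t)) has_vector_derivative fderiv f (1,0) (s,t)) (at s)"
    and "((\<lambda>t. f (s,t)) has_vector_derivative fderiv f (0,1) (s,t)) (at t)"
proof -
  note D = smooth_on_has_derivative[OF f S]
  have lin: "frechet_derivative f (at (s,t)) (h *\<^sub>R w) = h *\<^sub>R frechet_derivative f (at (s,t)) w" for h w
    using has_derivative_linear[OF D] linear_cmul by blast
  have "((\<lambda>s. (s,t)) has_derivative (\<lambda>h. (h,0))) (at s)"
    by (auto intro!: derivative_eq_intros)
  from has_derivative_compose[OF this D]
  show "((\<lambda>s. f (s,t)) has_vector_derivative fderiv f (1,0) (s,t)) (at s)"
    unfolding has_vector_derivative_def lin[symmetric] by simp
  have "((\<lambda>t. (s,t)) has_derivative (\<lambda>h. (0,h))) (at t)"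
    by (auto intro!: derivative_eq_intros)
  from has_derivative_compose[OF this D]
  show "((\<lambda>t. f (s,t)) has_vector_derivative fderiv f (0,1) (s,t)) (at t)"
    unfolding has_vector_derivative_def lin[symmetric] by simp
qed

text \<open>Write \<open>f (s,x) = f (s,t\<^sub>1) + \<integral> \<partial>\<^sub>tf (s,u) du\<close> with the integral from \<open>t\<^sub>1\<close> to \<open>x\<close>, differentiate
  under the integral sign with respect to \<open>s\<close>, and then with respect to \<open>x\<close> by the fundamental
  theorem of calculus.\<close>

lemma smooth_on_mixed_derivatives:
  fixes f :: "real \<times> real \<Rightarrow> complex"
  assumes f: "smooth_on (UNIV \<times> {l<..<r}) f" and t: "t \<in> {l<..<r}"
  shows "fderiv (fderiv f (1,0)) (0,1) (s,t) = fderiv (fderiv f (0,1)) (1,0) (s,t)"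
proof -
  obtain t1 t2 where b: "l < t1" "t1 < t" "t < t2" "t2 < r"
    using t dense[of l t] dense[of t r] by auto
  let ?ft = "fderiv f (0,1)" and ?fs = "fderiv f (1,0)" and ?fts = "fderiv (fderiv f (0,1)) (1,0)"
  have S: "(s',u) \<in> UNIV \<times> {l<..<r}" if "u \<in> {t1..t2}" for s' u using that b by auto
  note f1 = smooth_on_fderiv[OF f]
  have cont: "continuous_on {t1..x} (\<lambda>u. g (s',u))"
    if "continuous_on (UNIV \<times> {l<..<r}) g" "x \<le> t2" for g :: "real \<times> real \<Rightarrow> complex" and s' x
    by (rule continuous_on_compose2[OF that(1)]) (use b that(2) in \<open>auto intro!: continuous_intros\<close>)
  have eq: "?fs (s,x) = ?fs (s,t1) + integral {t1..x} (\<lambda>u. ?fts (s,u))" if x: "x \<in> {t1..t2}" for x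
  proof -
    have "((\<lambda>s'. integral (cbox t1 x) (\<lambda>u. ?ft (s',u))) has_vector_derivative
            integral (cbox t1 x) (\<lambda>u. ?fts (s,u))) (at s within UNIV)"
    proof (rule leibniz_rule_vector_derivative)
      show "((\<lambda>s'. ?ft (s',u)) has_vector_derivative ?fts (s',u)) (at s' within UNIV)"
        if "u \<in> cbox t1 x" for s' u
        using smooth_on_partial_derivatives(1)[OF f1 S[of u s']] that x by simp
      show "(\<lambda>u. ?ft (s',u)) integrable_on cbox t1 x" for s'
        unfolding cbox_interval
        by (rule integrable_continuous_real, rule cont[OF smooth_on_continuous[OF f1]]) (use x in auto)
      show "continuous_on (UNIV \<times> cbox t1 x) (\<lambda>(s',u). ?fts (s',u))"
        using continuous_on_subset[OF smooth_on_continuous[OF smooth_on_fderiv[OF f1]]] x b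
        by (auto simp: case_prod_eta intro!: continuous_on_subset[OF smooth_on_continuous[OF smooth_on_fderiv[OF f1]]])
    qed auto
    moreover have "integral (cbox t1 x) (\<lambda>u. ?ft (s',u)) = f (s',x) - f (s',t1)" for s'
      unfolding cbox_interval
      by (rule integral_unique, rule fundamental_theorem_of_calculus)
         (use x in \<open>auto intro!: has_vector_derivative_at_within smooth_on_partial_derivatives(2)[OF f S]\<close>)
    ultimately have "((\<lambda>s'. f (s',x) - f (s',t1)) has_vector_derivative
        integral {t1..x} (\<lambda>u. ?fts (s,u))) (at s)"
      by (simp add: cbox_interval)
    moreover have "((\<lambda>s'. f (s',x) - f (s',t1)) has_vector_derivative ?fs (s,x) - ?fs (s,t1)) (at s)"
      using x b by (intro has_vector_derivative_diff smooth_on_partial_derivatives(1)[OF f] S) auto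
    ultimately have "?fs (s,x) - ?fs (s,t1) = integral {t1..x} (\<lambda>u. ?fts (s,u))"
      by (rule vector_derivative_unique_at[symmetric])
    then show ?thesis by (simp add: algebra_simps)
  qed
  have "((\<lambda>x. integral {t1..x} (\<lambda>u. ?fts (s,u))) has_vector_derivative ?fts (s,t)) (at t within {t1..t2})"
    by (rule integral_has_vector_derivative)
       (use b cont[OF smooth_on_continuous[OF smooth_on_fderiv[OF f1]]] in auto)
  then have "((\<lambda>x. ?fs (s,t1) + integral {t1..x} (\<lambda>u. ?fts (s,u))) has_vector_derivative ?fts (s,t)) (at t within {t1..t2})"
    using has_vector_derivative_add[OF has_vector_derivative_const] by fastforce
  then have "((\<lambda>x. ?fs (s,x)) has_vector_derivative ?fts (s,t)) (at t within {t1..t2})"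
    using b by (intro has_vector_derivative_transform[OF _ eq]) auto
  then have "((\<lambda>x. ?fs (s,x)) has_vector_derivative ?fts (s,t)) (at t)"
    using b by (simp add: at_within_Icc_at)
  moreover have "((\<lambda>x. ?fs (s,x)) has_vector_derivative fderiv ?fs (0,1) (s,t)) (at t)"
    using t by (intro smooth_on_partial_derivatives(2)[OF f1]) auto
  ultimately show ?thesis by (rule vector_derivative_unique_at[symmetric])
qed

text \<open>The symmetry of the second derivatives is expressed by the occurrence of the same \<open>Fst\<close> in the
  last two properties.\<close>

lemma smooth_mat_partial_derivatives:
  assumes F: "smooth_mat d (UNIV \<times> {l<..<r}) (\<lambda>(s,t). F s t)"
  obtains Fs Ft Fst where
    "\<And>s t. t \<in> {l<..<r} \<Longrightarrow> mat_has_deriv d (\<lambda>s. F s t) (Fs s t) s"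
    "\<And>s t. t \<in> {l<..<r} \<Longrightarrow> mat_has_deriv d (F s) (Ft s t) t"
    "\<And>s t. t \<in> {l<..<r} \<Longrightarrow> mat_has_deriv d (Fs s) (Fst s t) t"
    "\<And>s t. t \<in> {l<..<r} \<Longrightarrow> mat_has_deriv d (\<lambda>s. Ft s t) (Fst s t) s"
proof -
  define e where "e = (\<lambda>i j x. (case x of (s,t) \<Rightarrow> F s t) $$ (i,j))"
  have sm: "smooth_on (UNIV \<times> {l<..<r}) (e i j)" if "i < d" "j < d" for i j
    using F that by (simp add: smooth_mat_def e_def)
  have Fc: "F s t \<in> carrier_mat d d" if "t \<in> {l<..<r}" for s t
    using F that by (auto simp: smooth_mat_def)
  define mk where "mk = (\<lambda>(h::nat \<Rightarrow> nat \<Rightarrow> real \<times> real \<Rightarrow> complex) s t. mat d d (\<lambda>(i,j). h i j (s,t)))"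
  have ev: "\<forall>\<^sub>F x in nhds t. x \<in> {l<..<r}" if "t \<in> {l<..<r}" for t
    by (rule eventually_nhds_in_open) (use that in auto)
  have F_mk: "F s t = mk e s t" if "t \<in> {l<..<r}" for s t
    using carrier_matD[OF Fc[OF that]] by (intro eq_matI) (simp_all add: mk_def e_def)
  have ds: "mat_has_deriv d (\<lambda>s. mk h s t) (mk (\<lambda>i j. fderiv (h i j) (1,0)) s t) s"
    and dt: "mat_has_deriv d (mk h s) (mk (\<lambda>i j. fderiv (h i j) (0,1)) s t) t"
    if "t \<in> {l<..<r}" "\<And>i j. i < d \<Longrightarrow> j < d \<Longrightarrow> smooth_on (UNIV \<times> {l<..<r}) (h i j)" for h s t
    using that smooth_on_partial_derivatives[OF that(2), of _ _ s t]
    by (auto simp: mat_has_deriv_def mk_def)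
  let ?s = "\<lambda>i j. fderiv (e i j) (1,0)" and ?t = "\<lambda>i j. fderiv (e i j) (0,1)"
  show thesis
  proof (rule that[of "mk ?s" "mk ?t" "mk (\<lambda>i j. fderiv (fderiv (e i j) (1,0)) (0,1))"])
    fix s t assume t: "t \<in> {l<..<r}"
    show "mat_has_deriv d (\<lambda>s. F s t) (mk ?s s t) s"
      using ds[OF t, of e s] sm F_mk[OF t] by simp
    have "mat_has_deriv d (mk e s) (mk ?t s t) t" using dt[OF t, of e s] sm by blast
    moreover have "\<forall>\<^sub>F x in nhds t. mk e s x = F s x" using ev[OF t] by eventually_elim (simp add: F_mk)
    ultimately show "mat_has_deriv d (F s) (mk ?t s t) t" by (rule mat_has_deriv_transform)
    show "mat_has_deriv d (mk ?s s) (mk (\<lambda>i j. fderiv (fderiv (e i j) (1,0)) (0,1)) s t) t"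
      using dt[OF t, of ?s s] smooth_on_fderiv[OF sm] by blast
    have "mk (\<lambda>i j. fderiv (fderiv (e i j) (1,0)) (0,1)) s t = mk (\<lambda>i j. fderiv (fderiv (e i j) (0,1)) (1,0)) s t"
      unfolding mk_def by (rule cong_mat) (use smooth_on_mixed_derivatives[OF sm t] in auto)
    then show "mat_has_deriv d (\<lambda>s. mk ?t s t) (mk (\<lambda>i j. fderiv (fderiv (e i j) (1,0)) (0,1)) s t) s"
      using ds[OF t, of ?t s] smooth_on_fderiv[OF sm] by simp
  qed
qed

lemma smooth_mat_has_deriv:
  assumes "smooth_mat d S F" "t \<in> S" "open S"
  shows "mat_has_deriv d F (mat_deriv F t) t"
proof -
  have "\<forall>\<^sub>F x in nhds t. x \<in> S" by (rule eventually_nhds_in_open) (use assms in auto)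
  then have "\<forall>\<^sub>F x in nhds t. F x \<in> carrier_mat d d"
    by eventually_elim (use assms(1) in \<open>simp add: smooth_mat_def\<close>)
  moreover have "F t \<in> carrier_mat d d" using assms by (simp add: smooth_mat_def)
  ultimately show ?thesis
    using assms smooth_on_differentiable
    by (fastforce simp: mat_has_deriv_def mat_deriv_def smooth_mat_def)
qed

section \<open>Gauge transformations and their velocities\<close>

text \<open>By this lemma the three gauge transformations that make up \<open>\<Phi>\<close> on the first interval can be
  treated as one.\<close>

lemma gauge_compose:
  assumes g: "mat_has_deriv d g g' t" "g t \<in> GL d" and h: "mat_has_deriv d h h' t" "h t \<in> GL d"
    and p: "fst p t \<in> carrier_mat d d" "snd p t \<in> carrier_mat d d"
  shows "fst (gauge g (gauge h p)) t = fst (gauge (\<lambda>t. g t * h t) p) t"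
    and "snd (gauge g (gauge h p)) t = snd (gauge (\<lambda>t. g t * h t) p) t"
proof -
  note gi = minv_GL[OF g(2)] and hi = minv_GL[OF h(2)]
  note c = GL_carrier[OF g(2)] GL_carrier[OF h(2)] gi(1) hi(1) mat_has_derivD(3)[OF g(1)] mat_has_derivD(3)[OF h(1)] p
  note s = sq_distrib[of _ d] sq_smult[of _ d] sq_carrier
    inverse_cancel[OF c(1) c(3) gi(2,3)] inverse_cancel[OF c(2) c(4) hi(2,3)] gi hi
  have inv: "minv (g t * h t) = minv (h t) * minv (g t)"
    by (rule GL_inverseI(2)[of _ d]) (simp_all only: c s)
  have d: "mat_deriv (\<lambda>t. g t * h t) t = g' * h t + g t * h'" "mat_deriv g t = g'" "mat_deriv h t = h'"
    using mat_deriv_eq[OF mat_has_deriv_mult[OF g(1) h(1)]] mat_deriv_eq[OF g(1)] mat_deriv_eq[OF h(1)] by auto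
  have e: "X - (1/2) \<cdot>\<^sub>m Y - (1/2) \<cdot>\<^sub>m Z = X - (1/2) \<cdot>\<^sub>m (Z + Y)"
    if "X \<in> carrier_mat d d" "Y \<in> carrier_mat d d" "Z \<in> carrier_mat d d" for X Y Z :: "complex mat"
    using that by (auto intro!: eq_matI simp: algebra_simps)
  show "fst (gauge g (gauge h p)) t = fst (gauge (\<lambda>t. g t * h t) p) t"
    unfolding gauge_def fst_conv snd_conv d inv by (simp only: c s e)
  show "snd (gauge g (gauge h p)) t = snd (gauge (\<lambda>t. g t * h t) p) t"
    unfolding gauge_def fst_conv snd_conv d inv by (simp only: c s)
qed

text \<open>Here the point of the interval is fixed and the parameter of the curve varies; \<open>Kt\<close> stands for the
  derivative of the gauge transformation along the interval and \<open>M\<close> for its mixed derivative, so that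
  \<open>H * M - H * Kt u * x\<close> is the derivative of \<open>x\<close> along the interval.\<close>

lemma gauge_velocity:
  fixes K Kt A B :: "real \<Rightarrow> complex mat"
  assumes K: "mat_has_deriv d K Ks u" "\<forall>\<^sub>F x in nhds u. K x \<in> GL d"
    and Kt: "mat_has_deriv d Kt M u" and A: "mat_has_deriv d A a u" and B: "mat_has_deriv d B b u"
  defines "H \<equiv> minv (K u)"
  defines "x \<equiv> H * Ks"
  shows "mat_has_deriv d (\<lambda>s. K s * A s * minv (K s) - (1/2) \<cdot>\<^sub>m (Kt s * minv (K s)))
      (K u * (a + (x * A u - A u * x) - (1/2) \<cdot>\<^sub>m (H * M - H * Kt u * x)) * H) u"
    and "mat_has_deriv d (\<lambda>s. K s * B s * minv (K s)) (K u * (b + (x * B u - B u * x)) * H) u"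
proof -
  have Ku: "K u \<in> GL d" using K(2) eventually_nhds_x_imp_x by blast
  note Hi = minv_GL[OF Ku, folded H_def]
  note c = GL_carrier[OF Ku] Hi(1) mat_has_derivD(3)[OF K(1)] mat_has_derivD(2,3)[OF Kt]
    mat_has_derivD(2,3)[OF A] mat_has_derivD(2,3)[OF B]
  note s = sq_distrib[of _ d] sq_smult[of _ d] sq_carrier
    inverse_cancel[OF c(1) c(2) Hi(2,3)]
  note dH = mat_has_deriv_minv[OF K, folded H_def]
  note dA = mat_has_deriv_diff[OF mat_has_deriv_mult[OF mat_has_deriv_mult[OF K(1) A] dH]
      mat_has_deriv_smult[OF mat_has_deriv_mult[OF Kt dH], of "1/2"], folded H_def]
  note dB = mat_has_deriv_mult[OF mat_has_deriv_mult[OF K(1) B] dH, folded H_def]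
  have "(Ks * A u + K u * a) * H + (K u * A u) * ((-1) \<cdot>\<^sub>m (H * Ks * H))
        - (1/2) \<cdot>\<^sub>m (M * H + Kt u * ((-1) \<cdot>\<^sub>m (H * Ks * H)))
     = K u * (a + (x * A u - A u * x) - (1/2) \<cdot>\<^sub>m (H * M - H * Kt u * x)) * H"
    unfolding x_def
    by (simp only: c s, rule eq_matI) (use c in \<open>simp_all add: sq_carrier algebra_simps del: index_mult_mat(1)\<close>)
  then show "mat_has_deriv d (\<lambda>s. K s * A s * minv (K s) - (1/2) \<cdot>\<^sub>m (Kt s * minv (K s)))
      (K u * (a + (x * A u - A u * x) - (1/2) \<cdot>\<^sub>m (H * M - H * Kt u * x)) * H) u"
    using dA by simp
  have "(Ks * B u + K u * b) * H + (K u * B u) * ((-1) \<cdot>\<^sub>m (H * Ks * H))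
     = K u * (b + (x * B u - B u * x)) * H"
    unfolding x_def
    by (simp only: c s, rule eq_matI) (use c in \<open>simp_all add: sq_carrier algebra_simps del: index_mult_mat(1)\<close>)
  then show "mat_has_deriv d (\<lambda>s. K s * B s * minv (K s)) (K u * (b + (x * B u - B u * x)) * H) u"
    using dB by simp
qed

lemma mat_has_deriv_cmult:
  assumes f: "mat_has_deriv d f f' u" and C: "C \<in> carrier_mat d d"
  shows "mat_has_deriv d (\<lambda>x. C * f x) (C * f') u" "mat_has_deriv d (\<lambda>x. f x * C) (f' * C) u"
  using mat_has_deriv_mult[OF mat_has_deriv_const[OF C] f] mat_has_deriv_mult[OF f mat_has_deriv_const[OF C]]
    mat_has_derivD(2,3)[OF f] C by (simp_all add: left_add_zero_mat[of _ d d] right_add_zero_mat[of _ d d])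

text \<open>A curve \<open>s \<mapsto> (A s, B s)\<close> of solutions of the complex equation together with a moving gauge
  transformation \<open>K s\<close>.  The functions \<open>a\<close>, \<open>b\<close>, \<open>Ks\<close> are derivatives with respect to \<open>s\<close> at \<open>s = 0\<close>,
  \<open>Bt\<close>, \<open>Kt\<close> those with respect to \<open>t\<close>, and \<open>bt\<close>, \<open>Kst\<close> the mixed ones, obtained in either order.\<close>

locale gauged_curve =
  fixes d :: nat and l r :: real and A B K Bt Kt :: "real \<Rightarrow> mat_fun" and a b bt Ks Kst :: mat_fun
  assumes A: "t \<in> {l<..<r} \<Longrightarrow> mat_has_deriv d (\<lambda>s. A s t) (a t) 0"
    and B: "t \<in> {l<..<r} \<Longrightarrow> mat_has_deriv d (\<lambda>s. B s t) (b t) 0"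
    and Bt: "t \<in> {l<..<r} \<Longrightarrow> mat_has_deriv d (B s) (Bt s t) t"
    and b: "t \<in> {l<..<r} \<Longrightarrow> mat_has_deriv d b (bt t) t"
    and Bts: "t \<in> {l<..<r} \<Longrightarrow> mat_has_deriv d (\<lambda>s. Bt s t) (bt t) 0"
    and complex_eq: "t \<in> {l<..<r} \<Longrightarrow> Bt s t = 2 \<cdot>\<^sub>m (B s t * A s t - A s t * B s t)"
    and K: "t \<in> {l<..<r} \<Longrightarrow> mat_has_deriv d (\<lambda>s. K s t) (Ks t) 0"
    and Kt: "t \<in> {l<..<r} \<Longrightarrow> mat_has_deriv d (K s) (Kt s t) t"
    and Ks: "t \<in> {l<..<r} \<Longrightarrow> mat_has_deriv d Ks (Kst t) t"
    and Kts: "t \<in> {l<..<r} \<Longrightarrow> mat_has_deriv d (\<lambda>s. Kt s t) (Kst t) 0"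
    and GL: "t \<in> {l<..<r} \<Longrightarrow> K s t \<in> GL d"
begin

definition xi :: mat_fun where "xi t = minv (K 0 t) * Ks t"

definition xi_dot :: mat_fun where
  "xi_dot t = minv (K 0 t) * Kst t - minv (K 0 t) * Kt 0 t * xi t"

lemma carriers:
  assumes "t \<in> {l<..<r}"
  shows "A 0 t \<in> carrier_mat d d" "B 0 t \<in> carrier_mat d d" "a t \<in> carrier_mat d d"
    "b t \<in> carrier_mat d d" "K 0 t \<in> carrier_mat d d" "minv (K 0 t) \<in> carrier_mat d d"
    "Ks t \<in> carrier_mat d d" "Kst t \<in> carrier_mat d d" "Kt 0 t \<in> carrier_mat d d"
    "xi t \<in> carrier_mat d d" "xi_dot t \<in> carrier_mat d d"
proof -
  show c: "A 0 t \<in> carrier_mat d d" "B 0 t \<in> carrier_mat d d" "a t \<in> carrier_mat d d"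
    "b t \<in> carrier_mat d d" "K 0 t \<in> carrier_mat d d" "minv (K 0 t) \<in> carrier_mat d d"
    "Ks t \<in> carrier_mat d d" "Kst t \<in> carrier_mat d d" "Kt 0 t \<in> carrier_mat d d"
    using mat_has_derivD(2,3)[OF A[OF assms]] mat_has_derivD(2,3)[OF B[OF assms]]
      GL_carrier[OF GL[OF assms]] minv_GL(1)[OF GL[OF assms]] mat_has_derivD(3)[OF K[OF assms]]
      mat_has_derivD(2,3)[OF Kts[OF assms]] by auto
  then show "xi t \<in> carrier_mat d d" "xi_dot t \<in> carrier_mat d d" by (simp_all only: xi_def xi_dot_def sq_carrier)
qed

lemma xi_has_deriv:
  assumes t: "t \<in> {l<..<r}"
  shows "mat_has_deriv d xi (xi_dot t) t"
proof -
  have ev: "\<forall>\<^sub>F t in nhds t. K 0 t \<in> GL d"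
    by (rule eventually_mono[OF eventually_nhds_in_open[of "{l<..<r}"]]) (use t GL in auto)
  have "xi_dot t = (-1) \<cdot>\<^sub>m (minv (K 0 t) * Kt 0 t * minv (K 0 t)) * Ks t + minv (K 0 t) * Kst t"
    using carriers[OF t]
    by (simp only: xi_dot_def xi_def sq_distrib[of _ d] sq_smult[of _ d] sq_carrier)
       (auto intro!: eq_matI simp: sq_carrier simp del: index_mult_mat(1))
  then show ?thesis
    using mat_has_deriv_mult[OF mat_has_deriv_minv[OF Kt[OF t] ev] Ks[OF t]]
    by (simp add: xi_def[abs_def])
qed

text \<open>Differentiate the complex equation with respect to \<open>s\<close>; the symmetry of the second derivatives
  makes the left-hand side the derivative of \<open>b\<close> along the interval.\<close>

lemma linearized_complex_eq:
  assumes t: "t \<in> {l<..<r}"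
  shows "bt t = 2 \<cdot>\<^sub>m (B 0 t * a t - a t * B 0 t) + 2 \<cdot>\<^sub>m (b t * A 0 t - A 0 t * b t)"
proof -
  note c = carriers[OF t]
  have "mat_has_deriv d (\<lambda>s. Bt s t) (2 \<cdot>\<^sub>m ((b t * A 0 t + B 0 t * a t) - (a t * B 0 t + A 0 t * b t))) 0"
    unfolding complex_eq[OF t]
    by (intro mat_has_deriv_smult mat_has_deriv_diff mat_has_deriv_mult A B t)
  from mat_has_deriv_unique[OF Bts[OF t] this]
  show ?thesis
    using c by (auto intro!: eq_matI simp: sq_carrier algebra_simps simp del: index_mult_mat(1))
qed

lemma gauge_velocities:
  assumes t: "t \<in> {l<..<r}"
  shows "mat_has_deriv d (\<lambda>s. fst (gauge (K s) (A s, B s)) t)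
      (K 0 t * (a t + (xi t * A 0 t - A 0 t * xi t) - (1/2) \<cdot>\<^sub>m xi_dot t) * minv (K 0 t)) 0"
    "mat_has_deriv d (\<lambda>s. snd (gauge (K s) (A s, B s)) t)
      (K 0 t * (b t + (xi t * B 0 t - B 0 t * xi t)) * minv (K 0 t)) 0"
proof -
  have ev: "\<forall>\<^sub>F s in nhds 0. K s t \<in> GL d" using GL[OF t] by simp
  show "mat_has_deriv d (\<lambda>s. fst (gauge (K s) (A s, B s)) t)
      (K 0 t * (a t + (xi t * A 0 t - A 0 t * xi t) - (1/2) \<cdot>\<^sub>m xi_dot t) * minv (K 0 t)) 0"
    using gauge_velocity(1)[OF K[OF t] ev Kts[OF t] A[OF t] B[OF t]]
    by (simp add: gauge_def mat_deriv_eq[OF Kt[OF t]] xi_def xi_dot_def)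
  show "mat_has_deriv d (\<lambda>s. snd (gauge (K s) (A s, B s)) t)
      (K 0 t * (b t + (xi t * B 0 t - B 0 t * xi t)) * minv (K 0 t)) 0"
    using gauge_velocity(2)[OF K[OF t] ev Kts[OF t] A[OF t] B[OF t]]
    by (simp add: gauge_def xi_def)
qed

end

lemma velocity_gauged_curve:
  assumes "gauged_curve d l r A B K Bt Kt a b bt Ks Kst" and t: "t \<in> {l<..<r}"
    and P: "\<And>s. fst (P s) t = fst (gauge (K s) (A s, B s)) t" "\<And>s. snd (P s) t = snd (gauge (K s) (A s, B s)) t"
  defines "x \<equiv> gauged_curve.xi K Ks t" and "xd \<equiv> gauged_curve.xi_dot K Kt Ks Kst t"
  shows "fst (velocity d P) t = K 0 t * (a t + (x * A 0 t - A 0 t * x) - (1/2) \<cdot>\<^sub>m xd) * minv (K 0 t)"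
    "snd (velocity d P) t = K 0 t * (b t + (x * B 0 t - B 0 t * x)) * minv (K 0 t)"
  using mat_vector_derivative_eq[OF gauged_curve.gauge_velocities(1)[OF assms(1) t]]
    mat_vector_derivative_eq[OF gauged_curve.gauge_velocities(2)[OF assms(1) t]]
  by (simp_all add: velocity_def P x_def xd_def)

text \<open>The two curves pass through the same point at \<open>s = 0\<close>, where also the two gauge transformations
  agree; only their derivatives \<open>x\<close> and \<open>y\<close> differ.  Conjugation by the common value of the gauge
  transformation drops out of the trace.\<close>

lemma form_variation:
  assumes C: "gauged_curve d l r A B K Bt Kt a b bt Ks Kst"
    and C': "gauged_curve d l r A' B' K' Bt' Kt' a' b' bt' Ks' Kst'"
    and t: "t \<in> {l<..<r}"
    and eq: "A' 0 = A 0" "B' 0 = B 0" "\<And>t. t \<in> {l<..<r} \<Longrightarrow> K' 0 t = K 0 t"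
    and P: "\<And>s. fst (P s) t = fst (gauge (K s) (A s, B s)) t" "\<And>s. snd (P s) t = snd (gauge (K s) (A s, B s)) t"
    and P': "\<And>s. fst (P' s) t = fst (gauge (K' s) (A' s, B' s)) t" "\<And>s. snd (P' s) t = snd (gauge (K' s) (A' s, B' s)) t"
  defines "x \<equiv> gauged_curve.xi K Ks" and "y \<equiv> gauged_curve.xi K' Ks'"
  shows "((\<lambda>t. (1/2) * (mtrace (y t * b t) - mtrace (x t * b' t) - mtrace ((x t * y t - y t * x t) * B 0 t)))
     has_vector_derivative
       mtrace (fst (velocity d P) t * snd (velocity d P') t - fst (velocity d P') t * snd (velocity d P) t)
       - mtrace (a t * b' t - a' t * b t)) (at t)"
proof -
  interpret C: gauged_curve d l r A B K Bt Kt a b bt Ks Kst by (rule C)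
  interpret C': gauged_curve d l r A' B' K' Bt' Kt' a' b' bt' Ks' Kst' by (rule C')
  note c = C.carriers[OF t, folded x_def] C'.carriers[OF t, folded y_def, unfolded eq eq(3)[OF t]]
  define xd where "xd = C.xi_dot t"
  define yd where "yd = C'.xi_dot t"
  have xdc: "xd \<in> carrier_mat d d" "yd \<in> carrier_mat d d" using c by (simp_all add: xd_def yd_def)
  note x = C.xi_has_deriv[OF t, folded x_def xd_def] and y = C'.xi_has_deriv[OF t, folded y_def yd_def]
  let ?H = "minv (K 0 t)"
  have HK: "?H * K 0 t = 1\<^sub>m d" using minv_GL(3)[OF C.GL[OF t]] .
  note v = velocity_gauged_curve[OF C t P, folded x_def xd_def]
    velocity_gauged_curve[OF C' t P', folded y_def yd_def, unfolded eq eq(3)[OF t]]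
  let ?U = "a t + (x t * A 0 t - A 0 t * x t) - (1/2) \<cdot>\<^sub>m xd" and ?V = "b t + (x t * B 0 t - B 0 t * x t)"
  let ?U' = "a' t + (y t * A 0 t - A 0 t * y t) - (1/2) \<cdot>\<^sub>m yd" and ?V' = "b' t + (y t * B 0 t - B 0 t * y t)"
  have UV: "?U \<in> carrier_mat d d" "?V \<in> carrier_mat d d" "?U' \<in> carrier_mat d d" "?V' \<in> carrier_mat d d"
    using c xdc by (simp_all only: sq_carrier)
  note lin = mtrace_linear(2)[of _ d]
  have "mtrace (fst (velocity d P) t * snd (velocity d P') t - fst (velocity d P') t * snd (velocity d P) t)
     = mtrace ((K 0 t * ?U * ?H) * (K 0 t * ?V' * ?H)) - mtrace ((K 0 t * ?U' * ?H) * (K 0 t * ?V * ?H))"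
    unfolding v by (rule lin) (use UV c in \<open>simp_all only: sq_carrier\<close>)
  also have "\<dots> = mtrace (?U * ?V') - mtrace (?U' * ?V)"
    by (simp only: mtrace_conj[OF c(5,6) HK] UV)
  also have "\<dots> = mtrace (?U * ?V' - ?U' * ?V)"
    by (rule lin[symmetric]) (use UV in \<open>simp_all only: sq_carrier\<close>)
  also have "\<dots> = mtrace (a t * b' t - a' t * b t)
     + (1/2) * (mtrace (yd * b t + y t * bt t) - mtrace (xd * b' t + x t * bt' t)
       - mtrace (((xd * y t + x t * yd) - (yd * x t + y t * xd)) * B 0 t + (x t * y t - y t * x t) * Bt 0 t))"
    by (rule trace_form_gauge_variation[of _ d])
       (use c xdc C.linearized_complex_eq[OF t] C'.linearized_complex_eq[OF t] C.complex_eq[OF t] eq in auto)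
  finally have e: "mtrace (fst (velocity d P) t * snd (velocity d P') t - fst (velocity d P') t * snd (velocity d P) t)
       - mtrace (a t * b' t - a' t * b t)
     = (1/2) * (mtrace (yd * b t + y t * bt t) - mtrace (xd * b' t + x t * bt' t)
       - mtrace (((xd * y t + x t * yd) - (yd * x t + y t * xd)) * B 0 t + (x t * y t - y t * x t) * Bt 0 t))"
    by simp
  show ?thesis
    unfolding e
    by (intro has_vector_derivative_mult_right has_vector_derivative_diff mtrace_has_vector_derivative[of d]
        mat_has_deriv_mult mat_has_deriv_diff x y C.b C'.b C.Bt t)
qed

lemma gauge_cong:
  "fst p t = fst q t \<Longrightarrow> fst (gauge g p) t = fst (gauge g q) t"
  "snd p t = snd q t \<Longrightarrow> snd (gauge g p) t = snd (gauge g q) t"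
  by (simp_all add: gauge_def)

lemma gauge_carrier:
  assumes g: "mat_has_deriv d g g' t" "g t \<in> GL d" and p: "fst p t \<in> carrier_mat d d" "snd p t \<in> carrier_mat d d"
  shows "fst (gauge g p) t \<in> carrier_mat d d" "snd (gauge g p) t \<in> carrier_mat d d"
  using minv_GL(1)[OF g(2)] GL_carrier[OF g(2)] p mat_has_derivD(3)[OF g(1)] mat_deriv_eq[OF g(1)]
  by (simp_all only: gauge_def fst_conv snd_conv sq_carrier)

lemma upper_left_carrier: "A \<in> carrier_mat d d \<Longrightarrow> upper_left d A = A"
  by (auto simp: upper_left_def)

section \<open>Matrices supported on a transitive relation\<close>

definition supported_on :: "nat \<Rightarrow> (nat \<Rightarrow> nat \<Rightarrow> bool) \<Rightarrow> complex mat \<Rightarrow> bool" where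
  "supported_on d R A \<longleftrightarrow> A \<in> carrier_mat d d \<and> (\<forall>a<d. \<forall>b<d. \<not> R a b \<longrightarrow> A $$ (a,b) = 0)"

text \<open>For irreflexive \<open>R\<close>: the identity plus a matrix supported on \<open>R\<close>.\<close>

definition unipotent_on :: "nat \<Rightarrow> (nat \<Rightarrow> nat \<Rightarrow> bool) \<Rightarrow> complex mat \<Rightarrow> bool" where
  "unipotent_on d R A \<longleftrightarrow> A \<in> carrier_mat d d \<and>
     (\<forall>a<d. \<forall>b<d. \<not> R a b \<longrightarrow> A $$ (a,b) = (if a = b then 1 else 0))"

lemma supported_on_diff:
  "supported_on d R A \<Longrightarrow> supported_on d R B \<Longrightarrow> supported_on d R (A - B)"
  by (auto simp: supported_on_def)

lemma supported_on_mult: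
  assumes "transp R" "supported_on d R A" "supported_on d R B"
  shows "supported_on d R (A * B)"
proof -
  have "A $$ (a,c) * B $$ (c,b) = 0" if "\<not> R a b" "a < d" "b < d" "c < d" for a b c
    using assms that by (metis supported_on_def mult_eq_0_iff transpD)
  then show ?thesis
    using assms
    by (auto simp: supported_on_def index_mult_sum[of _ d] simp del: index_mult_mat(1) intro!: sum.neutral)
qed

lemma mtrace_supported_on:
  assumes "supported_on d R A" "B \<in> carrier_mat d d"
    and "\<And>a b. a < d \<Longrightarrow> b < d \<Longrightarrow> R a b \<Longrightarrow> B $$ (b,a) = 0"
  shows "mtrace (A * B) = 0"
proof -
  have "A $$ (a,b) * B $$ (b,a) = 0" if "a < d" "b < d" for a b
    using assms that by (cases "R a b") (auto simp: supported_on_def)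
  then show ?thesis using assms by (subst mtrace_mult[of _ d]) (auto simp: supported_on_def intro!: sum.neutral)
qed

lemma unipotent_on_mult:
  assumes "transp R" "\<And>a b. R a b \<Longrightarrow> b < a" "unipotent_on d R A" "unipotent_on d R B"
  shows "unipotent_on d R (A * B)"
  unfolding unipotent_on_def
proof (intro conjI allI impI)
  fix a b assume ab: "a < d" "b < d" "\<not> R a b"
  have "A $$ (a,c) * B $$ (c,b) = (if c = a then if a = b then 1 else 0 else 0)" if "c < d" for c
  proof (cases "R a c \<or> R c b")
    case True
    show ?thesis
    proof (cases "R a c \<and> R c b")
      case True
      then show ?thesis using assms(1) ab by (meson transpD)
    next
      case False
      with True show ?thesis using assms(2-4) ab that by (auto simp: unipotent_on_def split: if_splits)
    qed
  next
    case False
    then show ?thesis using assms(3,4) ab that by (auto simp: unipotent_on_def)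
  qed
  then have "(\<Sum>c<d. A $$ (a,c) * B $$ (c,b)) = (\<Sum>c<d. if c = a then if a = b then 1 else 0 else 0)"
    by (intro sum.cong) auto
  then show "(A * B) $$ (a,b) = (if a = b then 1 else 0)"
    using assms ab by (simp add: unipotent_on_def index_mult_sum[of _ d] del: index_mult_mat(1))
qed (use assms in \<open>auto simp: unipotent_on_def\<close>)

text \<open>Row \<open>a\<close> of \<open>U * Y\<close> is row \<open>a\<close> of \<open>Y\<close> plus multiples of rows \<open>c\<close> with \<open>R a c\<close>, which come earlier;
  this allows induction on \<open>a\<close>.\<close>

lemma supported_on_unipotent_cancel:
  assumes R: "transp R" "\<And>a b. R a b \<Longrightarrow> b < a" and U: "unipotent_on d R U"
    and Y: "Y \<in> carrier_mat d d" and UY: "supported_on d R (U * Y)"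
  shows "supported_on d R Y"
proof -
  have "\<forall>b<d. \<not> R a b \<longrightarrow> Y $$ (a,b) = 0" if "a < d" for a
    using that
  proof (induction a rule: less_induct)
    case (less a)
    show ?case
    proof (intro allI impI)
      fix b assume b: "b < d" "\<not> R a b"
      have "U $$ (a,c) * Y $$ (c,b) = (if c = a then Y $$ (a,b) else 0)" if c: "c < d" for c
      proof (cases "R a c")
        case True
        then have "c < a" "\<not> R c b" using R b by (auto dest: transpD)
        then show ?thesis using less c b by auto
      next
        case False
        then show ?thesis using U c less.prems by (auto simp: unipotent_on_def)
      qed
      then have "(\<Sum>c<d. U $$ (a,c) * Y $$ (c,b)) = (\<Sum>c<d. if c = a then Y $$ (a,b) else 0)"
        by (intro sum.cong) auto
      also have "\<dots> = Y $$ (a,b)" using less.prems by simp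
      finally show "Y $$ (a,b) = 0"
        using UY U Y less.prems b
        by (simp add: supported_on_def unipotent_on_def index_mult_sum[of _ d] del: index_mult_mat(1))
    qed
  qed
  then show ?thesis using Y by (simp add: supported_on_def)
qed

lemma unipotent_on_deriv:
  assumes G: "mat_has_deriv d G G' u" and U: "\<And>s. unipotent_on d R (G s)"
  shows "supported_on d R G'"
  unfolding supported_on_def
proof (intro conjI allI impI)
  show "G' \<in> carrier_mat d d" by (rule mat_has_derivD(3)[OF G])
  fix a b assume ab: "a < d" "b < d" "\<not> R a b"
  have "(\<lambda>s. G s $$ (a,b)) = (\<lambda>s. if a = b then 1 else 0)"
    using U ab by (auto simp: unipotent_on_def)
  then have "((\<lambda>s. G s $$ (a,b)) has_vector_derivative 0) (at u)" by simp
  then show "G' $$ (a,b) = 0"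
    using mat_has_derivD(4)[OF G ab(1,2)] vector_derivative_unique_at by blast
qed

lemma deriv_vanishes:
  assumes G: "mat_has_deriv d G G' u" and ab: "a < d" "b < d" and z: "\<And>s. G s $$ (a,b) = 0"
  shows "G' $$ (a,b) = 0"
proof -
  have "((\<lambda>s. G s $$ (a,b)) has_vector_derivative 0) (at u)" by (simp add: z)
  then show ?thesis using mat_has_derivD(4)[OF G ab] vector_derivative_unique_at by blast
qed

lemma conj_mtrace_supported_on:
  assumes c: "r \<in> carrier_mat d d" "E \<in> carrier_mat d d" "b \<in> carrier_mat d d"
    and Y: "supported_on d R Y"
    and b: "\<And>p q. p < d \<Longrightarrow> q < d \<Longrightarrow> R p q \<Longrightarrow> (r * b * E) $$ (q,p) = 0"
  shows "mtrace ((E * Y * r) * b) = 0"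
proof -
  have Yc: "Y \<in> carrier_mat d d" using Y by (simp add: supported_on_def)
  have "mtrace ((E * Y * r) * b) = mtrace (Y * (r * b * E))"
    using mtrace_rotate4[OF c(2) Yc c(1,3)] by (simp only: c Yc sq_distrib[of _ d] sq_carrier)
  also have "\<dots> = 0"
    by (rule mtrace_supported_on[OF Y _ b]) (use c in \<open>simp_all only: sq_carrier\<close>)
  finally show ?thesis .
qed

text \<open>The conjugations by \<open>r\<close> cancel under the trace, and matrices supported on a transitive relation
  are closed under commutators and have trace zero against matrices that vanish at the transposed
  positions.\<close>

lemma boundary_term_vanishes:
  assumes c: "r \<in> carrier_mat d d" "E \<in> carrier_mat d d" "r * E = 1\<^sub>m d" "E * r = 1\<^sub>m d"
      "b \<in> carrier_mat d d" "b' \<in> carrier_mat d d" "be \<in> carrier_mat d d"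
    and R: "transp R" and Y: "supported_on d R Y" "supported_on d R Y'"
    and z: "\<And>p q. p < d \<Longrightarrow> q < d \<Longrightarrow> R p q \<Longrightarrow> (r * b * E) $$ (q,p) = 0"
      "\<And>p q. p < d \<Longrightarrow> q < d \<Longrightarrow> R p q \<Longrightarrow> (r * b' * E) $$ (q,p) = 0"
      "\<And>p q. p < d \<Longrightarrow> q < d \<Longrightarrow> R p q \<Longrightarrow> (r * be * E) $$ (q,p) = 0"
    and x: "x = E * Y * r" and y: "y = E * Y' * r"
  shows "mtrace (y * b) - mtrace (x * b') - mtrace ((x * y - y * x) * be) = 0"
proof -
  have Yc: "Y \<in> carrier_mat d d" "Y' \<in> carrier_mat d d" using Y by (simp_all add: supported_on_def)
  have "x * y - y * x = E * (Y * Y' - Y' * Y) * r"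
    unfolding x y by (simp only: c Yc sq_distrib[of _ d] sq_carrier inverse_cancel[OF c(1-4)])
  moreover have "supported_on d R (Y * Y' - Y' * Y)"
    by (intro supported_on_diff supported_on_mult R Y)
  ultimately show ?thesis
    using conj_mtrace_supported_on[OF c(1,2,7) _ z(3)] conj_mtrace_supported_on[OF c(1,2,5) Y(2) z(1)]
      conj_mtrace_supported_on[OF c(1,2,6) Y(1) z(2)] by (simp add: x y)
qed

section \<open>The correcting factors are block unipotent\<close>

lemma boff_Suc: "1 \<le> p \<Longrightarrow> p \<le> n \<Longrightarrow> boff n k (Suc p) = boff n k p + bsize n k p"
  by (simp add: boff_def msize_def bsize_def sum.atLeast_Suc_atMost Suc_diff_le)

lemma boff_1: "boff n k 1 = 0"
  by (simp add: boff_def msize_def)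

lemma boff_mono: "1 \<le> p \<Longrightarrow> p \<le> q \<Longrightarrow> boff n k p \<le> boff n k q"
  by (auto simp: boff_def msize_def intro!: sum_mono2)

lemma boff_bsize_le:
  assumes "1 \<le> p" "p < q" "q \<le> n + 1"
  shows "boff n k p + bsize n k p \<le> boff n k q"
  using boff_Suc[of p n k] boff_mono[of "Suc p" q n k] assms by simp

lemma ex_block:
  assumes "b < boff n k i" "1 \<le> i" "i \<le> n + 1"
  shows "\<exists>j. 1 \<le> j \<and> j < i \<and> boff n k j \<le> b \<and> b < boff n k j + bsize n k j"
  using assms(2,1,3)
proof (induction i rule: dec_induct)
  case base
  then show ?case by (simp add: boff_1[simplified])
next
  case (step i)
  then show ?case using boff_Suc[of i n k] by (cases "b < boff n k i") (fastforce intro: exI[of _ i])+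
qed

lemma bsize_mono:
  assumes "\<And>i. 1 \<le> i \<Longrightarrow> i < n \<Longrightarrow> k (i + 1) \<le> k i" "1 \<le> j" "j \<le> i" "i \<le> n"
  shows "bsize n k j \<le> bsize n k i"
  using assms(3,4)
proof (induction i rule: dec_induct)
  case (step i)
  have "k (n - i + 1) \<le> k (n - i)" by (rule assms(1)) (use step assms(2) in auto)
  then have "bsize n k i \<le> bsize n k (Suc i)" using step by (simp add: bsize_def Suc_diff_le)
  then show ?case using step by simp
qed simp

text \<open>The positions below the block diagonal at which the factors of \<open>\<gamma>\<^sub>B\<close> may have entries: outside the
  last row of each block.  The block of \<open>b\<close> is not named, which makes transitivity immediate.\<close>

definition block_lower :: "nat \<Rightarrow> (nat \<Rightarrow> nat) \<Rightarrow> nat \<Rightarrow> nat \<Rightarrow> bool" where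
  "block_lower n k a b \<longleftrightarrow>
     (\<exists>i. 1 \<le> i \<and> i \<le> n \<and> b < boff n k i \<and> boff n k i \<le> a \<and> a + 1 < boff n k i + bsize n k i)"

lemma block_lower_less: "block_lower n k a b \<Longrightarrow> b < a"
  by (auto simp: block_lower_def)

lemma transp_block_lower: "transp (block_lower n k)"
proof (rule transpI)
  fix a b c assume R: "block_lower n k a b" "block_lower n k b c"
  then show "block_lower n k a c"
    using block_lower_less[OF R(2)] unfolding block_lower_def by (meson order.strict_trans)
qed

text \<open>Position \<open>(b,a)\<close> is above the block diagonal and outside the last column of its block.\<close>

lemma M_k_vanishes:
  assumes B: "B \<in> M_k n k" and R: "block_lower n k a b"
  shows "B $$ (b,a) = 0"
proof -
  from R obtain i where i: "1 \<le> i" "i \<le> n" "b < boff n k i" "boff n k i \<le> a" "a + 1 < boff n k i + bsize n k i"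
    by (auto simp: block_lower_def)
  from ex_block[of b n k i] i obtain j where
    j: "1 \<le> j" "j < i" "boff n k j \<le> b" "b < boff n k j + bsize n k j" by auto
  have upper: "\<forall>i\<in>{1..n}. \<forall>j\<in>{1..n}. i < j \<longrightarrow> (\<forall>r<bsize n k i. \<forall>s. s + 1 < bsize n k j \<longrightarrow>
        block n k B i j $$ (r,s) = 0)" using B by (simp add: M_k_def)
  have "block n k B j i $$ (b - boff n k j, a - boff n k i) = 0"
    using upper[rule_format, of j i "b - boff n k j" "a - boff n k i"] i j by auto
  then show ?thesis using i j by (simp add: block_def)
qed

text \<open>A nonzero entry of the \<open>(i,j)\<close>-block, \<open>j < i\<close>, lies in a row that precedes some column of the
  block.  It is not the last row, because block \<open>i\<close> has at least as many rows as block \<open>j\<close> has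
  columns; this is the monotonicity of \<open>k\<close>.\<close>

lemma unipotent_gamma_factor:
  assumes k: "\<And>i. 1 \<le> i \<Longrightarrow> i < n \<Longrightarrow> k (i + 1) \<le> k i" and ij: "1 \<le> j" "j < i" "i \<le> n"
  shows "unipotent_on (msize n k 1) (block_lower n k) (gamma_factor n k i j A)"
proof -
  have "block_lower n k a b"
    if "boff n k i \<le> a" "boff n k j \<le> b" "b < boff n k j + bsize n k j" "a - boff n k i < b - boff n k j" for a b
    unfolding block_lower_def
    by (rule exI[of _ i]) (use that ij bsize_mono[of n k, OF k, of j i] boff_bsize_le[of j i n k] in auto)
  then show ?thesis
    by (auto simp: unipotent_on_def gamma_factor_def Let_def simp del: nu.simps dest: block_lower_less)
qed

lemma unipotent_gamma_mat:
  assumes k: "\<And>i. 1 \<le> i \<Longrightarrow> i < n \<Longrightarrow> k (i + 1) \<le> k i"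
  shows "unipotent_on (msize n k 1) (block_lower n k) (gamma_mat n k B)"
proof -
  let ?U = "unipotent_on (msize n k 1) (block_lower n k)"
  have "?U (fold (\<lambda>(i,j) G. gamma_factor n k i j (G * B * minv G) * G) ps G)"
    if "\<forall>(i,j)\<in>set ps. 1 \<le> j \<and> j < i \<and> i \<le> n" "?U G" for ps G
    using that
  proof (induction ps arbitrary: G)
    case (Cons p ps)
    obtain i j where p: "p = (i,j)" by (cases p)
    have "?U (gamma_factor n k i j (G * B * minv G) * G)"
      by (rule unipotent_on_mult[OF transp_block_lower block_lower_less unipotent_gamma_factor[of n k, OF k]])
         (use Cons p in auto)
    then show ?case using Cons p by simp
  qed simp
  moreover have "?U (1\<^sub>m (msize n k 1))" by (auto simp: unipotent_on_def dest: block_lower_less)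
  ultimately show ?thesis unfolding gamma_mat_def by auto
qed

section \<open>The regularizing gauge at the right end\<close>

text \<open>The principal branch jumps across the negative axis, but along it \<open>Ln t = ln (- t) + \<i> \<pi>\<close>.\<close>

lemma complex_of_real_powr_derivative:
  assumes "t < 0"
  shows "((\<lambda>t. complex_of_real t powr c) has_vector_derivative (c / of_real t) * complex_of_real t powr c) (at t)"
proof -
  have eq: "complex_of_real x powr c = exp (c * (of_real (ln (- x)) + \<i> * of_real pi))" if "x < 0" for x
  proof -
    have "Ln (complex_of_real x) = of_real (ln (- x)) + \<i> * of_real pi"
      using Ln_minus[of "of_real (- x)"] that Ln_of_real[of "- x"] by simp
    then show ?thesis using that by (simp add: powr_def)
  qed
  have "((\<lambda>x. exp (c * (complex_of_real (ln (- x)) + \<i> * of_real pi))) has_vector_derivative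
      (c / of_real t) * exp (c * (of_real (ln (- t)) + \<i> * of_real pi))) (at t)"
  proof -
    have "((\<lambda>x. ln (- x)) has_field_derivative 1 / t) (at t)"
      using assms by (auto intro!: derivative_eq_intros)
    then have "((\<lambda>x. complex_of_real (ln (- x))) has_vector_derivative of_real (1 / t)) (at t)"
      by (rule has_vector_derivative_of_real)
    then have "((\<lambda>x. c * (complex_of_real (ln (- x)) + \<i> * of_real pi)) has_vector_derivative c * (of_real (1 / t) + 0)) (at t)"
      by (intro has_vector_derivative_mult_right has_vector_derivative_add has_vector_derivative_const)
    from field_vector_diff_chain_at[OF this DERIV_exp]
    show ?thesis by (simp add: o_def)
  qed
  then show ?thesis
    unfolding eq[OF assms]
    by (rule has_vector_derivative_transform_within_open[of _ _ _ "{..<0}"]) (use assms eq in auto)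
qed

lemma diagonal_mat_mult_index:
  fixes D A :: "complex mat"
  assumes "D \<in> carrier_mat d d" "diagonal_mat D" "A \<in> carrier_mat d d" "i < d" "j < d"
  shows "(D * A) $$ (i,j) = D $$ (i,i) * A $$ (i,j)" "(A * D) $$ (i,j) = A $$ (i,j) * D $$ (j,j)"
proof -
  have "(\<Sum>l<d. D $$ (i,l) * A $$ (l,j)) = (\<Sum>l<d. if l = i then D $$ (i,i) * A $$ (i,j) else 0)"
    using assms by (intro sum.cong) (auto simp: diagonal_mat_def)
  then show "(D * A) $$ (i,j) = D $$ (i,i) * A $$ (i,j)"
    using assms by (simp add: index_mult_sum[of _ d] del: index_mult_mat(1))
  have "(\<Sum>l<d. A $$ (i,l) * D $$ (l,j)) = (\<Sum>l<d. if l = j then A $$ (i,j) * D $$ (j,j) else 0)"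
    using assms by (intro sum.cong) (auto simp: diagonal_mat_def)
  then show "(A * D) $$ (i,j) = A $$ (i,j) * D $$ (j,j)"
    using assms by (simp add: index_mult_sum[of _ d] del: index_mult_mat(1))
qed

lemma diag_powr_carrier: "X \<in> carrier_mat d d \<Longrightarrow> diag_powr t X \<in> carrier_mat d d"
  and diagonal_diag_powr: "diagonal_mat (diag_powr t X)"
  by (auto simp: diag_powr_def diagonal_mat_def)

lemma diag_powr_inverse:
  assumes X: "X \<in> carrier_mat d d" and t: "t \<noteq> 0"
  shows "diag_powr t (2 \<cdot>\<^sub>m X) * diag_powr t ((-2) \<cdot>\<^sub>m X) = 1\<^sub>m d"
    and "diag_powr t ((-2) \<cdot>\<^sub>m X) * diag_powr t (2 \<cdot>\<^sub>m X) = 1\<^sub>m d"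
proof -
  have c: "diag_powr t (2 \<cdot>\<^sub>m X) \<in> carrier_mat d d" "diag_powr t ((-2) \<cdot>\<^sub>m X) \<in> carrier_mat d d"
    using X by (simp_all add: diag_powr_carrier)
  have e: "complex_of_real t powr (2 * x) * complex_of_real t powr (- (2 * x)) = 1"
    "complex_of_real t powr (- (2 * x)) * complex_of_real t powr (2 * x) = 1" for x
    using t by (simp_all add: powr_add[symmetric])
  show "diag_powr t (2 \<cdot>\<^sub>m X) * diag_powr t ((-2) \<cdot>\<^sub>m X) = 1\<^sub>m d"
    "diag_powr t ((-2) \<cdot>\<^sub>m X) * diag_powr t (2 \<cdot>\<^sub>m X) = 1\<^sub>m d"
    using X c
    by (auto intro!: eq_matI simp: diagonal_mat_mult_index[of _ d] diagonal_diag_powr simp del: index_mult_mat(1))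
       (auto simp: diag_powr_def e)
qed

lemma mat_has_deriv_diag_powr:
  assumes X: "X \<in> carrier_mat d d" "diagonal_mat X" and t: "t < l"
  shows "mat_has_deriv d (\<lambda>t. diag_powr (t - l) X) ((1 / of_real (t - l)) \<cdot>\<^sub>m (X * diag_powr (t - l) X)) t"
proof -
  have "((\<lambda>t. complex_of_real (t - l) powr c) has_vector_derivative
      (c / of_real (t - l)) * complex_of_real (t - l) powr c) (at t)" for c
  proof -
    have "((\<lambda>t. t - l) has_vector_derivative 1) (at t)" by (auto intro!: derivative_eq_intros)
    from vector_diff_chain_at[OF this complex_of_real_powr_derivative[of "t - l" c]] t
    show ?thesis by (simp add: o_def)
  qed
  note power = this
  let ?D = "diag_powr (t - l) X"
  have D: "?D \<in> carrier_mat d d" using X(1) by (rule diag_powr_carrier)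
  have XD: "X * ?D \<in> carrier_mat d d" using X(1) D by simp
  have "((\<lambda>t. diag_powr (t - l) X $$ (i,j)) has_vector_derivative
      ((1 / of_real (t - l)) \<cdot>\<^sub>m (X * ?D)) $$ (i,j)) (at t)" if ij: "i < d" "j < d" for i j
  proof -
    have "((1 / of_real (t - l)) \<cdot>\<^sub>m (X * ?D)) $$ (i,j) = (1 / of_real (t - l)) * (X * ?D) $$ (i,j)"
      using ij carrier_matD[OF XD] by (simp only: index_smult_mat)
    also have "(X * ?D) $$ (i,j) = X $$ (i,i) * ?D $$ (i,j)"
      by (rule diagonal_mat_mult_index[OF X D ij])
    finally show ?thesis
      using ij X(1) power[of "X $$ (i,i)"] by (cases "i = j") (auto simp: diag_powr_def)
  qed
  then show ?thesis using X(1) XD by (auto simp: mat_has_deriv_def diag_powr_carrier)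
qed

lemma diagonal_diag_block_mat:
  "(\<forall>A\<in>set As. square_mat A \<and> diagonal_mat A) \<Longrightarrow>
     diagonal_mat (diag_block_mat As) \<and> square_mat (diag_block_mat As)"
  by (induction As) (auto simp: diagonal_mat_def Let_def)

lemma xN_mat:
  shows xN_mat_carrier: "xN_mat n k \<in> carrier_mat (msize n k 1) (msize n k 1)"
    and diagonal_xN_mat: "diagonal_mat (xN_mat n k)"
proof -
  have "sum_list (map (bsize n k) [1..<p]) = boff n k p" if "1 \<le> p" "p \<le> n + 1" for p
    using that by (induction p rule: dec_induct) (auto simp: boff_1[simplified] boff_Suc)
  from this[of "n + 1"] have "sum_list (map (bsize n k) [1..<n+1]) = msize n k 1" by (simp add: boff_def)
  then show "xN_mat n k \<in> carrier_mat (msize n k 1) (msize n k 1)"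
    by (auto simp: xN_mat_def dim_diag_block_mat o_def xmat_def)
  show "diagonal_mat (xN_mat n k)"
    unfolding xN_mat_def using diagonal_diag_block_mat
    by (rule conjunct1) (auto simp: xmat_def diagonal_mat_def)
qed

text \<open>Conjugation fixes the diagonal matrix \<open>X\<close>, and the logarithmic derivative of \<open>z\<^sup>2\<^sup>X\<close> is \<open>2 X / z\<close>,
  which cancels the pole of the first component.\<close>

lemma gauge_diag_powr:
  assumes X: "X \<in> carrier_mat d d" "diagonal_mat X" and B: "B \<in> carrier_mat d d" and t: "t < l"
    and g: "\<forall>\<^sub>F t in nhds t. g t = diag_powr (t - l) (2 \<cdot>\<^sub>m X)"
    and p: "fst p t = of_real (1 / (t - l)) \<cdot>\<^sub>m X"
      "snd p t = diag_powr (t - l) ((-2) \<cdot>\<^sub>m X) * B * diag_powr (t - l) (2 \<cdot>\<^sub>m X)"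
  shows "fst (gauge g p) t = 0\<^sub>m d d" "snd (gauge g p) t = B"
proof -
  let ?D = "diag_powr (t - l) (2 \<cdot>\<^sub>m X)" and ?E = "diag_powr (t - l) ((-2) \<cdot>\<^sub>m X)"
  have c: "?D \<in> carrier_mat d d" "?E \<in> carrier_mat d d" using X by (simp_all add: diag_powr_carrier)
  have DE: "?D * ?E = 1\<^sub>m d" "?E * ?D = 1\<^sub>m d" using diag_powr_inverse[OF X(1)] t by auto
  have inv: "minv ?D = ?E" by (rule GL_inverseI(2)[OF c DE])
  have gt: "g t = ?D" using g eventually_nhds_x_imp_x by fast
  have X2: "2 \<cdot>\<^sub>m X \<in> carrier_mat d d" "diagonal_mat (2 \<cdot>\<^sub>m X)" using X by (auto simp: diagonal_mat_def)
  have g': "mat_deriv g t = (1 / of_real (t - l)) \<cdot>\<^sub>m ((2 \<cdot>\<^sub>m X) * ?D)"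
    by (rule mat_deriv_eq[OF mat_has_deriv_transform[OF mat_has_deriv_diag_powr[OF X2 t]]])
       (use g in eventually_elim, simp)
  have DX: "?D * X = X * ?D"
    using X c by (intro eq_matI, auto simp: diagonal_mat_mult_index[of _ d] diagonal_diag_powr
        simp del: index_mult_mat(1)) (auto simp: diag_powr_def diagonal_mat_def)
  note s = sq_distrib[of _ d] sq_smult[of _ d] sq_carrier inverse_cancel[OF c DE] c X(1) B
  have "fst (gauge g p) t = of_real (1 / (t - l)) \<cdot>\<^sub>m (?D * X * ?E)
      - (1/2) \<cdot>\<^sub>m ((1 / of_real (t - l)) \<cdot>\<^sub>m (2 \<cdot>\<^sub>m (X * (?D * ?E))))"
    unfolding gauge_def fst_conv gt g' p inv by (simp only: s)
  also have "?D * X * ?E = X" unfolding DX using X(1) c DE by (simp add: sq_distrib[of _ d])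
  also have "X * (?D * ?E) = X" unfolding DE using X(1) by simp
  finally show "fst (gauge g p) t = 0\<^sub>m d d" using X(1) by (auto intro!: eq_matI)
  have "snd (gauge g p) t = ?D * (?E * (B * (?D * ?E)))"
    unfolding gauge_def snd_conv gt p inv by (simp only: s)
  also have "\<dots> = B" unfolding DE using inverse_cancel[OF c DE] B by simp
  finally show "snd (gauge g p) t = B" .
qed

lemma B_k_right_end:
  assumes b: "b \<in> B_k n k l1 lN eps" and g: "is_g_reg n k l1 lN eps g"
  obtains B where "B \<in> M_k n k"
    "\<And>t. t \<in> {lN - real n * eps<..<lN} \<Longrightarrow> fst (gauge g b) t = 0\<^sub>m (msize n k 1) (msize n k 1)"
    "\<And>t. t \<in> {lN - real n * eps<..<lN} \<Longrightarrow> snd (gauge g b) t = B"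
proof -
  obtain B where B: "B \<in> M_k n k" and
    p: "\<And>t. t \<in> {lN - real n * eps<..<lN} \<Longrightarrow> fst b t = of_real (1 / (t - lN)) \<cdot>\<^sub>m xN_mat n k \<and>
        snd b t = diag_powr (t - lN) ((-2) \<cdot>\<^sub>m xN_mat n k) * B *
              diag_powr (t - lN) (2 \<cdot>\<^sub>m xN_mat n k)"
    using b by (cases b) (auto simp: B_k_def)
  have Bc: "B \<in> carrier_mat (msize n k 1) (msize n k 1)" using B by (simp add: M_k_def)
  have ev: "\<forall>\<^sub>F t in nhds t. g t = diag_powr (t - lN) (2 \<cdot>\<^sub>m xN_mat n k)"
    if "t \<in> {lN - real n * eps<..<lN}" for t
    by (rule eventually_mono[OF eventually_nhds_in_open[of "{lN - real n * eps<..<lN}"]])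
       (use that g in \<open>auto simp: is_g_reg_def\<close>)
  show thesis
  proof (rule that[OF B])
    fix t assume t: "t \<in> {lN - real n * eps<..<lN}"
    then have "t < lN" by simp
    from gauge_diag_powr[OF xN_mat_carrier diagonal_xN_mat Bc this ev[OF t]] p[OF t]
    show "fst (gauge g b) t = 0\<^sub>m (msize n k 1) (msize n k 1)" "snd (gauge g b) t = B" by blast+
  qed
qed

section \<open>Two facts on integrals\<close>

text \<open>If \<open>h\<close> is not integrable then neither is \<open>f\<close>, and both integrals are \<open>0\<close> by convention.\<close>

lemma integral_eq_of_diff:
  fixes f h :: "real \<Rightarrow> complex"
  assumes "((\<lambda>t. f t - h t) has_integral 0) S"
  shows "integral S f = integral S h"
proof (cases "h integrable_on S")
  case True
  from has_integral_add[OF assms integrable_integral[OF True]] show ?thesis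
    by (simp add: integral_unique)
next
  case False
  have "\<not> f integrable_on S"
  proof
    assume "f integrable_on S"
    from has_integral_diff[OF integrable_integral[OF this] assms] have "h integrable_on S"
      by (auto simp: integrable_on_def)
    with False show False ..
  qed
  with False show ?thesis by (simp add: not_integrable_integral)
qed

lemma integral_eq_0_if_0_inside:
  fixes f :: "real \<Rightarrow> complex"
  assumes "\<And>t. t \<in> {p<..<q} \<Longrightarrow> f t = 0"
  shows "integral {p..q} f = 0"
proof -
  have "integral {p..q} f = integral {p..q} (\<lambda>_. 0)"
    by (rule integral_spike[of "{p,q}"]) (use assms in \<open>auto simp: negligible_finite\<close>)
  then show ?thesis by simp
qed

section \<open>The pullback of the form\<close>

locale construction =
  fixes n :: nat and k :: "nat \<Rightarrow> nat" and l1 lN eps :: real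
    and g_reg :: mat_fun and g :: "nahm_pair \<Rightarrow> mat_fun" and g_H :: "nat \<Rightarrow> mat_fun"
  assumes n: "n \<ge> 2"
    and k_antimono: "\<And>i. 1 \<le> i \<Longrightarrow> i < n \<Longrightarrow> k (i + 1) \<le> k i"
    and eps: "eps > 0" "lN - real n * eps > l1"
    and g_reg: "is_g_reg n k l1 lN eps g_reg"
    and g: "is_g_choice n k l1 lN eps g_reg g"
    and g_H: "is_g_H n k l1 lN eps g_H"
begin

(* keeps the argument 1 of msize in one syntactic form *)
declare One_nat_def [simp del]

abbreviation "m \<equiv> msize n k 1"
abbreviation "l2 \<equiv> lam n l1 lN eps 2"
abbreviation "J \<equiv> {l1<..<lN}"
abbreviation "right_end \<equiv> {lN - real n * eps<..<lN}"
abbreviation "slice \<equiv> B_k n k l1 lN eps"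
abbreviation "PHI \<equiv> Phi n k g_reg g g_H"

definition step2_gauge :: "nahm_pair \<Rightarrow> mat_fun" where "step2_gauge b = g (gauge g_reg b)"
definition total_gauge :: "nahm_pair \<Rightarrow> mat_fun" where "total_gauge b t = g_H 1 t * step2_gauge b t * g_reg t"

lemma lam_1: "lam n l1 lN eps 1 = l1" by (simp add: lam_def)

lemma l2: "l1 < lN - real n * eps" "lN - real n * eps < l2" "l2 < lN"
  using n eps by (auto simp: lam_def algebra_simps)

lemma I_open_1: "I_open n l1 lN eps 1 = {l1<..<l2}" 
  by (simp only: I_open_def lam_1 one_add_one)

lemma I_open_subset_right_end:
  assumes i: "2 \<le> i" "i \<le> n"
  shows "I_open n l1 lN eps i \<subseteq> right_end"
proof -
  have "(real n + 1 - real i) * eps \<le> real n * eps" "0 \<le> (real n + 1 - real (i + 1)) * eps"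
    using i eps(1) by (simp_all add: mult_right_mono)
  moreover have "lam n l1 lN eps i = lN - (real n + 1 - real i) * eps"
    "lam n l1 lN eps (i + 1) = lN - (real n + 1 - real (i + 1)) * eps"
    using i by (simp_all add: lam_def add.commute)
  ultimately have "lN - real n * eps \<le> lam n l1 lN eps i" "lam n l1 lN eps (i + 1) \<le> lN"
    by simp_all
  then show ?thesis unfolding I_open_def by (intro subsetI) simp
qed

lemma right_end_subset: "right_end \<subseteq> J" using l2(1) by (intro subsetI) simp

lemma g_reg_props:
  assumes "t \<in> J"
  shows "mat_has_deriv m g_reg (mat_deriv g_reg t) t" "g_reg t \<in> GL m"
  using g_reg assms by (auto simp: is_g_reg_def intro: smooth_mat_has_deriv)

lemma g_H_props:
  assumes "i \<in> {1..n}" "t \<in> I_open n l1 lN eps i"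
  shows "mat_has_deriv (msize n k i) (g_H i) (mat_deriv (g_H i) t) t" "g_H i t \<in> GL (msize n k i)"
proof -
  have "smooth_mat (msize n k i) (I_open n l1 lN eps i) (g_H i)"
    "\<forall>t\<in>I_open n l1 lN eps i. g_H i t \<in> GL (msize n k i)"
    using g_H assms(1) unfolding is_g_H_def by blast+
  then show "mat_has_deriv (msize n k i) (g_H i) (mat_deriv (g_H i) t) t" "g_H i t \<in> GL (msize n k i)"
    using assms(2) smooth_mat_has_deriv[of _ "I_open n l1 lN eps i"] by (auto simp: I_open_def)
qed

lemma step2_gauge_props:
  assumes "b \<in> slice" "t \<in> J"
  shows "mat_has_deriv m (step2_gauge b) (mat_deriv (step2_gauge b) t) t" "step2_gauge b t \<in> GL m"
proof -
  have "smooth_mat m J (step2_gauge b)" "\<forall>t\<in>J. step2_gauge b t \<in> GL m"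
    using g assms(1) unfolding is_g_choice_def step2_gauge_def by blast+
  then show "mat_has_deriv m (step2_gauge b) (mat_deriv (step2_gauge b) t) t" "step2_gauge b t \<in> GL m"
    using assms(2) smooth_mat_has_deriv[of _ J] by auto
qed

lemma B_k_carrier:
  assumes "b \<in> slice" "t \<in> J"
  shows "fst b t \<in> carrier_mat m m" "snd b t \<in> carrier_mat m m"
  using assms by (auto simp: B_k_def smooth_mat_def)

lemma B_k_complex_equation:
  assumes "b \<in> slice" "t \<in> J"
  shows "mat_deriv (snd b) t + 2 \<cdot>\<^sub>m (fst b t * snd b t - snd b t * fst b t) = 0\<^sub>m m m"
proof -
  have "complex_equation J m (fst b) (snd b)" using assms(1) by (cases b) (simp add: B_k_def)
  then show ?thesis using assms(2) by (simp only: complex_equation_def)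
qed

lemma step1_carrier:
  assumes "b \<in> slice" "t \<in> J"
  shows "fst (gauge g_reg b) t \<in> carrier_mat m m" "snd (gauge g_reg b) t \<in> carrier_mat m m"
  using gauge_carrier[OF g_reg_props[OF assms(2)] B_k_carrier[OF assms]] .

lemma step2_gauge_end:
  assumes b: "b \<in> slice"
  obtains B where "B \<in> M_k n k" "\<And>t. t \<in> right_end \<Longrightarrow> snd (gauge g_reg b) t = B"
    "\<And>t. t \<in> right_end \<Longrightarrow> fst (gauge g_reg b) t = 0\<^sub>m m m"
    "\<And>t. t \<in> right_end \<Longrightarrow> step2_gauge b t = gamma_mat n k B"
proof -
  obtain B where B: "B \<in> M_k n k"
    "\<And>t. t \<in> right_end \<Longrightarrow> fst (gauge g_reg b) t = 0\<^sub>m m m"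
    "\<And>t. t \<in> right_end \<Longrightarrow> snd (gauge g_reg b) t = B"
    by (rule B_k_right_end[OF b g_reg]) blast
  have "\<forall>B\<in>M_k n k. (\<forall>t\<in>right_end. snd (gauge g_reg b) t = B) \<longrightarrow>
      (\<forall>t\<in>right_end. step2_gauge b t = gamma_mat n k B)"
    using bspec[OF conjunct1[OF g[unfolded is_g_choice_def]] b] unfolding step2_gauge_def by (elim conjE)
  then have "step2_gauge b t = gamma_mat n k B" if "t \<in> right_end" for t
    using B(1,3) that by simp
  then show thesis using B that[of B] by simp
qed

text \<open>The regularized \<open>\<alpha>\<close> vanishes here, and the gauge transformation \<open>\<gamma>\<^sub>B\<close> does not depend on \<open>t\<close>.\<close>

lemma step2_gauge_alpha_end:
  assumes b: "b \<in> slice" and t: "t \<in> right_end"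
  shows "fst (gauge (step2_gauge b) (gauge g_reg b)) t = 0\<^sub>m m m"
proof -
  obtain B where zero: "\<And>t. t \<in> right_end \<Longrightarrow> fst (gauge g_reg b) t = 0\<^sub>m m m"
    and B: "\<And>t. t \<in> right_end \<Longrightarrow> step2_gauge b t = gamma_mat n k B"
    by (rule step2_gauge_end[OF b]) blast
  have tJ: "t \<in> J" using t right_end_subset by auto
  note c = GL_carrier[OF step2_gauge_props(2)[OF b tJ]] minv_GL(1)[OF step2_gauge_props(2)[OF b tJ]]
  have "mat_has_deriv m (step2_gauge b) (0\<^sub>m m m) t"
  proof (rule mat_has_deriv_transform[OF mat_has_deriv_const])
    show "gamma_mat n k B \<in> carrier_mat m m" using c(1) B[OF t] by simp
    show "\<forall>\<^sub>F x in nhds t. gamma_mat n k B = step2_gauge b x"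
      by (rule eventually_mono[OF eventually_nhds_in_open[of right_end]]) (use t B in auto)
  qed
  note d0 = mat_deriv_eq[OF this]
  have "fst (gauge (step2_gauge b) (gauge g_reg b)) t = fst (gauge (step2_gauge b) ((\<lambda>t. 0\<^sub>m m m), undefined)) t"
    by (rule gauge_cong(1)) (simp add: zero[OF t])
  also have "\<dots> = 0\<^sub>m m m" using c by (simp add: gauge_def d0)
  finally show ?thesis .
qed

text \<open>All that \<open>\<Phi>\<close> leaves of \<open>\<alpha>\<close> is the derivative term of the last gauge transformation, which is the same
  for all points.\<close>

lemma velocity_Phi_end:
  assumes c: "\<And>s. c s \<in> slice" and i: "2 \<le> i" "i \<le> n" and t: "t \<in> I_open n l1 lN eps i"
  shows "fst (velocity (msize n k i) (\<lambda>s. PHI (c s) i)) t = 0\<^sub>m (msize n k i) (msize n k i)"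
proof -
  have te: "t \<in> right_end" using I_open_subset_right_end[OF i] t by auto
  have mi: "msize n k i \<le> m" using i by (auto simp: msize_def intro!: sum_mono2)
  have ul: "upper_left (msize n k i) (0\<^sub>m m m) = 0\<^sub>m (msize n k i) (msize n k i)"
    using mi by (auto simp: upper_left_def)
  have "fst (PHI (c s) i) t
      = fst (gauge (g_H i) ((\<lambda>t. 0\<^sub>m (msize n k i) (msize n k i)), undefined)) t" for s
    unfolding Phi_def Let_def step2_gauge_def[symmetric]
    by (rule gauge_cong(1)) (simp add: step2_gauge_alpha_end[OF c te] ul)
  then show ?thesis by (auto simp: velocity_def)
qed

text \<open>The first truncation keeps the whole matrix.\<close>

lemma Phi_first:
  assumes b: "b \<in> slice" and t: "t \<in> {l1<..<l2}"
  shows "fst (PHI b 1) t = fst (gauge (total_gauge b) b) t" "snd (PHI b 1) t = snd (gauge (total_gauge b) b) t"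
proof -
  have tJ: "t \<in> J" using t l2 by auto
  have tI: "t \<in> I_open n l1 lN eps 1" using t by (simp only: I_open_1)
  have 1: "1 \<in> {1..n}" using n by simp
  note h = g_H_props[OF 1 tI] and G = step2_gauge_props[OF b tJ] and r = g_reg_props[OF tJ]
  note c1 = step1_carrier[OF b tJ]
  note c2 = gauge_carrier[OF G c1]
  have hG: "mat_has_deriv m (\<lambda>t. g_H 1 t * step2_gauge b t) (mat_deriv (g_H 1) t * step2_gauge b t + g_H 1 t * mat_deriv (step2_gauge b) t) t"
    by (rule mat_has_deriv_mult[OF h(1) G(1)])
  have hG2: "g_H 1 t * step2_gauge b t \<in> GL m"
  proof (rule GL_inverseI(1))
    note c = GL_carrier[OF h(2)] minv_GL(1)[OF h(2)] GL_carrier[OF G(2)] minv_GL(1)[OF G(2)]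
    note i = inverse_cancel[OF c(1,2) minv_GL(2,3)[OF h(2)]] inverse_cancel[OF c(3,4) minv_GL(2,3)[OF G(2)]]
    show "g_H 1 t * step2_gauge b t \<in> carrier_mat m m" "minv (step2_gauge b t) * minv (g_H 1 t) \<in> carrier_mat m m"
      by (simp_all only: c sq_carrier)
    show "g_H 1 t * step2_gauge b t * (minv (step2_gauge b t) * minv (g_H 1 t)) = 1\<^sub>m m"
      "minv (step2_gauge b t) * minv (g_H 1 t) * (g_H 1 t * step2_gauge b t) = 1\<^sub>m m"
      by (simp_all only: c sq_carrier sq_distrib[of _ m] i minv_GL[OF h(2)] minv_GL[OF G(2)])
  qed
  have tot: "total_gauge b = (\<lambda>t. (g_H 1 t * step2_gauge b t) * g_reg t)" by (simp add: total_gauge_def fun_eq_iff)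
  show "fst (PHI b 1) t = fst (gauge (total_gauge b) b) t"
    unfolding Phi_def Let_def step2_gauge_def[symmetric] tot
      gauge_compose(1)[OF hG hG2 r B_k_carrier[OF b tJ], symmetric]
      gauge_compose(1)[OF h G c1, symmetric]
    by (rule gauge_cong(1)) (simp only: fst_conv upper_left_carrier[OF c2(1)])
  show "snd (PHI b 1) t = snd (gauge (total_gauge b) b) t"
    unfolding Phi_def Let_def step2_gauge_def[symmetric] tot
      gauge_compose(2)[OF hG hG2 r B_k_carrier[OF b tJ], symmetric]
      gauge_compose(2)[OF h G c1, symmetric]
    by (rule gauge_cong(2)) (simp only: snd_conv upper_left_carrier[OF c2(2)])
qed

lemma total_gauge_GL:
  assumes b: "b \<in> slice" and t: "t \<in> {l1<..<l2}"
  shows "total_gauge b t \<in> GL m" "minv (total_gauge b t) = minv (g_reg t) * minv (step2_gauge b t) * minv (g_H 1 t)"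
proof -
  have tJ: "t \<in> J" using t l2 by auto
  have tI: "t \<in> I_open n l1 lN eps 1" using t by (simp only: I_open_1)
  have 1: "1 \<in> {1..n}" using n by simp
  note h = g_H_props(2)[OF 1 tI] and G = step2_gauge_props(2)[OF b tJ] and r = g_reg_props(2)[OF tJ]
  note c = GL_carrier[OF h] minv_GL(1)[OF h] GL_carrier[OF G] minv_GL(1)[OF G] GL_carrier[OF r] minv_GL(1)[OF r]
  note i = inverse_cancel[OF c(1,2) minv_GL(2,3)[OF h]] inverse_cancel[OF c(3,4) minv_GL(2,3)[OF G]]
    inverse_cancel[OF c(5,6) minv_GL(2,3)[OF r]]
  have *: "total_gauge b t \<in> carrier_mat m m" "minv (g_reg t) * minv (step2_gauge b t) * minv (g_H 1 t) \<in> carrier_mat m m"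
    by (simp_all only: total_gauge_def c sq_carrier)
  have **: "total_gauge b t * (minv (g_reg t) * minv (step2_gauge b t) * minv (g_H 1 t)) = 1\<^sub>m m"
    "minv (g_reg t) * minv (step2_gauge b t) * minv (g_H 1 t) * total_gauge b t = 1\<^sub>m m"
    by (simp_all only: total_gauge_def c sq_carrier sq_distrib[of _ m] i minv_GL[OF h] minv_GL[OF r])
  show "total_gauge b t \<in> GL m" "minv (total_gauge b t) = minv (g_reg t) * minv (step2_gauge b t) * minv (g_H 1 t)"
    by (rule GL_inverseI[OF * **])+
qed

text \<open>Only the second of the three gauge transformations varies along the curve.  Near \<open>\<lambda>\<^sub>1\<close> it is \<open>1\<close> for
  all parameters near \<open>0\<close>, so \<open>\<xi>\<close> vanishes; near the right end it is \<open>\<gamma> = \<gamma>\<^sub>B\<close>, whose entries outside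
  \<^const>\<open>block_lower\<close> are constant, so \<open>\<xi>\<close> is \<open>\<gamma>\<^sup>-\<^sup>1 \<partial>\<^sub>s\<gamma>\<close> conjugated by the regularizing gauge
  transformation.\<close>

lemma first_interval_curve:
  assumes c: "B_k_curve n k l1 lN eps c"
  obtains Bt Kt bt Ks Kst where
    "gauged_curve m l1 l2 (\<lambda>s. fst (c s)) (\<lambda>s. snd (c s)) (\<lambda>s. total_gauge (c s)) Bt Kt
       (fst (velocity m c)) (snd (velocity m c)) bt Ks Kst"
    "\<forall>\<^sub>F t in at_right l1. gauged_curve.xi (\<lambda>s. total_gauge (c s)) Ks t = 0\<^sub>m m m"
    "\<And>t. t \<in> right_end \<Longrightarrow> t < l2 \<Longrightarrow> \<exists>Y. supported_on m (block_lower n k) Y \<and>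
       gauged_curve.xi (\<lambda>s. total_gauge (c s)) Ks t = minv (g_reg t) * Y * g_reg t"
proof -
  have cB: "c s \<in> slice" for s using c by (simp add: B_k_curve_def)
  have 1: "1 \<in> {1..n}" using n by simp
  have sub: "t \<in> J" "t \<in> I_open n l1 lN eps 1" if "t \<in> {l1<..<l2}" for t
    using that l2(3) by (auto simp: I_open_1)
  have sm: "smooth_mat m (UNIV \<times> J) (\<lambda>(s,t). fst (c s) t)" "smooth_mat m (UNIV \<times> J) (\<lambda>(s,t). snd (c s) t)"
    using c unfolding B_k_curve_def by blast+
  obtain As where A: "\<And>s t. t \<in> J \<Longrightarrow> mat_has_deriv m (\<lambda>s. fst (c s) t) (As s t) s"
    by (rule smooth_mat_partial_derivatives[OF sm(1)]) blast
  obtain Bs Bt Bst where B: "\<And>s t. t \<in> J \<Longrightarrow> mat_has_deriv m (\<lambda>s. snd (c s) t) (Bs s t) s"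
    "\<And>s t. t \<in> J \<Longrightarrow> mat_has_deriv m (snd (c s)) (Bt s t) t"
    "\<And>s t. t \<in> J \<Longrightarrow> mat_has_deriv m (Bs s) (Bst s t) t"
    "\<And>s t. t \<in> J \<Longrightarrow> mat_has_deriv m (\<lambda>s. Bt s t) (Bst s t) s"
    by (rule smooth_mat_partial_derivatives[OF sm(2)]) blast
  have gc: "smooth_mat m (UNIV \<times> J) (\<lambda>(s,t). step2_gauge (c s) t)"
    "\<forall>\<^sub>F (s,t) in nhds 0 \<times>\<^sub>F at_right l1. step2_gauge (c s) t = 1\<^sub>m m"
    using g c unfolding is_g_choice_def step2_gauge_def by blast+
  obtain Gs Gt Gst where G: "\<And>s t. t \<in> J \<Longrightarrow> mat_has_deriv m (\<lambda>s. step2_gauge (c s) t) (Gs s t) s"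
    "\<And>s t. t \<in> J \<Longrightarrow> mat_has_deriv m (step2_gauge (c s)) (Gt s t) t"
    "\<And>s t. t \<in> J \<Longrightarrow> mat_has_deriv m (Gs s) (Gst s t) t"
    "\<And>s t. t \<in> J \<Longrightarrow> mat_has_deriv m (\<lambda>s. Gt s t) (Gst s t) s"
    by (rule smooth_mat_partial_derivatives[OF gc(1)]) blast
  define h' where "h' = mat_deriv (g_H 1)"
  define r' where "r' = mat_deriv g_reg"
  note h = g_H_props(1)[OF 1, folded h'_def] and r = g_reg_props(1)[folded r'_def]
  have va: "fst (velocity m c) t = As 0 t" and vb: "snd (velocity m c) t = Bs 0 t" if "t \<in> J" for t
    using mat_vector_derivative_eq[OF A[OF that]] mat_vector_derivative_eq[OF B(1)[OF that]]
    by (simp_all add: velocity_def)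
  define Kt where "Kt = (\<lambda>s t. (h' t * step2_gauge (c s) t + g_H 1 t * Gt s t) * g_reg t + (g_H 1 t * step2_gauge (c s) t) * r' t)"
  define Ks where "Ks = (\<lambda>t. g_H 1 t * Gs 0 t * g_reg t)"
  define Kst where "Kst = (\<lambda>t. (h' t * Gs 0 t + g_H 1 t * Gst 0 t) * g_reg t + (g_H 1 t * Gs 0 t) * r' t)"
  have curve: "gauged_curve m l1 l2 (\<lambda>s. fst (c s)) (\<lambda>s. snd (c s)) (\<lambda>s. total_gauge (c s)) Bt Kt
       (fst (velocity m c)) (snd (velocity m c)) (Bst 0) Ks Kst"
  proof
    fix s t assume t: "t \<in> {l1<..<l2}"
    note tJ = sub(1)[OF t] and tI = sub(2)[OF t]
    note hc = mat_has_derivD(2,3)[OF h[OF tI]] and rc = mat_has_derivD(2,3)[OF r[OF tJ]]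
    show "mat_has_deriv m (\<lambda>s. fst (c s) t) (fst (velocity m c) t) 0" unfolding va[OF tJ] by (rule A[OF tJ])
    show "mat_has_deriv m (\<lambda>s. snd (c s) t) (snd (velocity m c) t) 0" unfolding vb[OF tJ] by (rule B(1)[OF tJ])
    show BtD: "mat_has_deriv m (snd (c s)) (Bt s t) t" by (rule B(2)[OF tJ])
    show "mat_has_deriv m (snd (velocity m c)) (Bst 0 t) t"
    proof (rule mat_has_deriv_transform[OF B(3)[OF tJ]])
      show "\<forall>\<^sub>F x in nhds t. Bs 0 x = snd (velocity m c) x"
        by (rule eventually_mono[OF eventually_nhds_in_open[of J]]) (use tJ vb in auto)
    qed
    show "mat_has_deriv m (\<lambda>s. Bt s t) (Bst 0 t) 0" by (rule B(4)[OF tJ])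
    show "Bt s t = 2 \<cdot>\<^sub>m (snd (c s) t * fst (c s) t - fst (c s) t * snd (c s) t)"
    proof -
      have eq: "Bt s t + 2 \<cdot>\<^sub>m (fst (c s) t * snd (c s) t - snd (c s) t * fst (c s) t) = 0\<^sub>m m m"
        using B_k_complex_equation[OF cB[of s] tJ] unfolding mat_deriv_eq[OF BtD] .
      note cc = B_k_carrier[OF cB[of s] tJ] mat_has_derivD(3)[OF BtD]
      have PQ: "fst (c s) t * snd (c s) t \<in> carrier_mat m m" "snd (c s) t * fst (c s) t \<in> carrier_mat m m"
        using cc by (simp_all only: sq_carrier)
      have "X = 2 \<cdot>\<^sub>m (Q - P)" if "X + 2 \<cdot>\<^sub>m (P - Q) = 0\<^sub>m m m"
        "X \<in> carrier_mat m m" "P \<in> carrier_mat m m" "Q \<in> carrier_mat m m" for X P Q :: "complex mat"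
      proof (rule eq_matI)
        fix i j assume "i < dim_row (2 \<cdot>\<^sub>m (Q - P))" "j < dim_col (2 \<cdot>\<^sub>m (Q - P))"
        then have ij: "i < m" "j < m" using that by auto
        have "(X + 2 \<cdot>\<^sub>m (P - Q)) $$ (i,j) = 0" unfolding that(1) using ij by simp
        then show "X $$ (i,j) = (2 \<cdot>\<^sub>m (Q - P)) $$ (i,j)" using ij that(2-4) by (simp add: algebra_simps eq_neg_iff_add_eq_0)
      qed (use that in auto)
      from this[OF eq cc(3) PQ] show ?thesis .
    qed
    show "mat_has_deriv m (\<lambda>s. total_gauge (c s) t) (Ks t) 0"
      unfolding total_gauge_def Ks_def by (intro mat_has_deriv_cmult G(1) tJ hc rc)
    show "mat_has_deriv m (total_gauge (c s)) (Kt s t) t"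
      unfolding total_gauge_def[abs_def] Kt_def by (intro mat_has_deriv_mult h r G(2) tI tJ)
    show "mat_has_deriv m Ks (Kst t) t"
      unfolding Ks_def Kst_def by (intro mat_has_deriv_mult h r G(3) tI tJ)
    show "mat_has_deriv m (\<lambda>s. Kt s t) (Kst t) 0"
      unfolding Kt_def Kst_def by (intro mat_has_deriv_add mat_has_deriv_cmult G tJ hc rc)
    show "total_gauge (c s) t \<in> GL m" by (rule total_gauge_GL(1)[OF cB t])
  qed
  have xi: "gauged_curve.xi (\<lambda>s. total_gauge (c s)) Ks t = minv (g_reg t) * (minv (step2_gauge (c 0) t) * Gs 0 t) * g_reg t"
    if t: "t \<in> {l1<..<l2}" for t
  proof -
    note tJ = sub(1)[OF t] and tI = sub(2)[OF t]
    note hG = g_H_props(2)[OF 1 tI] and GG = step2_gauge_props(2)[OF cB[of 0] tJ] and rG = g_reg_props(2)[OF tJ]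
    note cc = GL_carrier[OF hG] minv_GL(1)[OF hG] GL_carrier[OF GG] minv_GL(1)[OF GG] GL_carrier[OF rG] minv_GL(1)[OF rG]
      mat_has_derivD(3)[OF G(1)[OF tJ, of 0]]
    have "gauged_curve.xi (\<lambda>s. total_gauge (c s)) Ks t = minv (total_gauge (c 0) t) * Ks t"
      by (rule gauged_curve.xi_def[OF curve])
    then show ?thesis
      unfolding total_gauge_GL(2)[OF cB t] Ks_def
      by (simp only: cc sq_carrier sq_distrib[of _ m] inverse_cancel[OF cc(1,2) minv_GL(2,3)[OF hG]])
  qed
  show thesis
  proof (rule that[OF curve])
    from gc(2) obtain P Q where PQ: "\<forall>\<^sub>F s in nhds 0. P s" "\<forall>\<^sub>F t in at_right l1. Q t"
      "\<And>s t. P s \<Longrightarrow> Q t \<Longrightarrow> step2_gauge (c s) t = 1\<^sub>m m"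
      unfolding eventually_prod_filter by auto
    have "\<forall>\<^sub>F t in at_right l1. t \<in> {l1<..<l2}"
      by (rule eventually_at_right_real) (use l2 in simp)
    with PQ(2) show "\<forall>\<^sub>F t in at_right l1. gauged_curve.xi (\<lambda>s. total_gauge (c s)) Ks t = 0\<^sub>m m m"
    proof eventually_elim
      case (elim t)
      note tJ = sub(1)[OF elim(2)]
      have "mat_has_deriv m (\<lambda>s. step2_gauge (c s) t) (0\<^sub>m m m) 0"
        by (rule mat_has_deriv_transform[OF mat_has_deriv_const[OF one_carrier_mat]])
           (use PQ(1) in eventually_elim, use PQ(3) elim in simp)
      from mat_has_deriv_unique[OF G(1)[OF tJ] this] have "Gs 0 t = 0\<^sub>m m m" .
      then show ?case
        using xi[OF elim(2)] minv_GL(1)[OF g_reg_props(2)[OF tJ]] GL_carrier[OF g_reg_props(2)[OF tJ]]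
          minv_GL(1)[OF step2_gauge_props(2)[OF cB[of 0] tJ]] by simp
    qed
    fix t assume te: "t \<in> right_end" and tl: "t < l2"
    have t: "t \<in> {l1<..<l2}" and tJ: "t \<in> J" using te tl l2(1,3) by simp_all
    have U: "unipotent_on m (block_lower n k) (step2_gauge (c s) t)" for s
      using step2_gauge_end[OF cB[of s]] te unipotent_gamma_mat[of n k, OF k_antimono] by metis
    let ?Y = "minv (step2_gauge (c 0) t) * Gs 0 t"
    note GG = step2_gauge_props(2)[OF cB[of 0] tJ] 
    note cc = GL_carrier[OF GG] minv_GL(1)[OF GG] mat_has_derivD(3)[OF G(1)[OF tJ, of 0]]
    have "supported_on m (block_lower n k) ?Y"
    proof (rule supported_on_unipotent_cancel[OF transp_block_lower block_lower_less U])
      show "?Y \<in> carrier_mat m m" using cc by (simp only: sq_carrier)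
      have "step2_gauge (c 0) t * ?Y = Gs 0 t" by (rule inverse_cancel(1)[OF cc(1,2) minv_GL(2,3)[OF GG] cc(3)])
      then show "supported_on m (block_lower n k) (step2_gauge (c 0) t * ?Y)"
        using unipotent_on_deriv[OF G(1)[OF tJ] U] by simp
    qed
    then show "\<exists>Y. supported_on m (block_lower n k) Y \<and>
       gauged_curve.xi (\<lambda>s. total_gauge (c s)) Ks t = minv (g_reg t) * Y * g_reg t"
      using xi[OF t] by blast
  qed
qed

lemma velocity_alpha_end:
  assumes c: "\<And>s. c s \<in> slice" and t: "t \<in> right_end"
  shows "fst (velocity m c) t = 0\<^sub>m m m"
proof -
  have "fst (c s) t = of_real (1 / (t - lN)) \<cdot>\<^sub>m xN_mat n k" for s
    using c[of s] t by (cases "c s") (auto simp: B_k_def)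
  then show ?thesis by (auto simp: velocity_def)
qed

lemma step1_beta_vanishes:
  assumes b: "b \<in> slice" and t: "t \<in> right_end" and R: "block_lower n k p q"
  shows "(g_reg t * snd b t * minv (g_reg t)) $$ (q,p) = 0"
proof -
  from B_k_right_end[OF b g_reg] t obtain B where "B \<in> M_k n k" "snd (gauge g_reg b) t = B" by blast
  then show ?thesis using M_k_vanishes[OF _ R] by (simp add: gauge_def)
qed

text \<open>The regularized \<open>\<beta>\<close> stays in \<^const>\<open>M_k\<close> along the curve, so its entries at the transposed
  positions are constantly zero.\<close>

lemma step1_velocity_vanishes:
  assumes c: "B_k_curve n k l1 lN eps c" and t: "t \<in> right_end"
    and R: "block_lower n k p q" "p < m" "q < m"
  shows "(g_reg t * snd (velocity m c) t * minv (g_reg t)) $$ (q,p) = 0"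
proof -
  have cB: "c s \<in> slice" for s using c by (simp add: B_k_curve_def)
  have tJ: "t \<in> J" using t right_end_subset by blast
  have sm: "smooth_mat m (UNIV \<times> J) (\<lambda>(s,t). snd (c s) t)" using c unfolding B_k_curve_def by blast
  obtain Bs where B: "\<And>s t. t \<in> J \<Longrightarrow> mat_has_deriv m (\<lambda>s. snd (c s) t) (Bs s t) s"
    by (rule smooth_mat_partial_derivatives[OF sm]) blast
  note Bs = B[OF tJ, of 0]
  have v: "snd (velocity m c) t = Bs 0 t" using mat_vector_derivative_eq[OF Bs] by (simp add: velocity_def)
  note r = g_reg_props(2)[OF tJ]
  have "mat_has_deriv m (\<lambda>s. g_reg t * snd (c s) t * minv (g_reg t)) (g_reg t * Bs 0 t * minv (g_reg t)) 0"
    by (intro mat_has_deriv_cmult Bs GL_carrier minv_GL r)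
  from deriv_vanishes[OF this R(3,2)] show ?thesis
    unfolding v using step1_beta_vanishes[OF cB t R(1)] by blast
qed

lemma pullback_form:
  assumes c: "B_k_curve n k l1 lN eps c" and c': "B_k_curve n k l1 lN eps c'" and c0: "c 0 = c' 0"
  shows "omega_H n l1 lN eps (\<lambda>i. velocity (msize n k i) (\<lambda>s. PHI (c s) i))
       (\<lambda>i. velocity (msize n k i) (\<lambda>s. PHI (c' s) i))
     = omega_B l1 lN (velocity m c) (velocity m c')"
proof -
  have cB: "c s \<in> slice" "c' s \<in> slice" for s using c c' by (simp_all add: B_k_curve_def)
  obtain Bt Kt bt Ks Kst where
    C: "gauged_curve m l1 l2 (\<lambda>s. fst (c s)) (\<lambda>s. snd (c s)) (\<lambda>s. total_gauge (c s)) Bt Kt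
       (fst (velocity m c)) (snd (velocity m c)) bt Ks Kst"
    and xl: "\<forall>\<^sub>F t in at_right l1. gauged_curve.xi (\<lambda>s. total_gauge (c s)) Ks t = 0\<^sub>m m m"
    and xr: "\<And>t. t \<in> right_end \<Longrightarrow> t < l2 \<Longrightarrow> \<exists>Y. supported_on m (block_lower n k) Y \<and>
       gauged_curve.xi (\<lambda>s. total_gauge (c s)) Ks t = minv (g_reg t) * Y * g_reg t"
    by (rule first_interval_curve[OF c]) blast
  obtain Bt' Kt' bt' Ks' Kst' where
    C': "gauged_curve m l1 l2 (\<lambda>s. fst (c' s)) (\<lambda>s. snd (c' s)) (\<lambda>s. total_gauge (c' s)) Bt' Kt'
       (fst (velocity m c')) (snd (velocity m c')) bt' Ks' Kst'"
    and yl: "\<forall>\<^sub>F t in at_right l1. gauged_curve.xi (\<lambda>s. total_gauge (c' s)) Ks' t = 0\<^sub>m m m"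
    and yr: "\<And>t. t \<in> right_end \<Longrightarrow> t < l2 \<Longrightarrow> \<exists>Y. supported_on m (block_lower n k) Y \<and>
       gauged_curve.xi (\<lambda>s. total_gauge (c' s)) Ks' t = minv (g_reg t) * Y * g_reg t"
    by (rule first_interval_curve[OF c']) blast
  define x where "x = gauged_curve.xi (\<lambda>s. total_gauge (c s)) Ks"
  define y where "y = gauged_curve.xi (\<lambda>s. total_gauge (c' s)) Ks'"
  define V where "V = velocity m c"
  define V' where "V' = velocity m c'"
  define W where "W = velocity m (\<lambda>s. PHI (c s) 1)"
  define W' where "W' = velocity m (\<lambda>s. PHI (c' s) 1)"
  define F where "F = (\<lambda>t. (1/2) * (mtrace (y t * snd V t) - mtrace (x t * snd V' t)
      - mtrace ((x t * y t - y t * x t) * snd (c 0) t)))"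
  define fB where "fB = (\<lambda>t. mtrace (fst V t * snd V' t - fst V' t * snd V t))"
  define fH where "fH = (\<lambda>t. mtrace (fst W t * snd W' t - fst W' t * snd W t))"
  have bc: "snd (c 0) t \<in> carrier_mat m m" "snd V t \<in> carrier_mat m m" "snd V' t \<in> carrier_mat m m"
    if "t \<in> {l1<..<l2}" for t
    using that l2(3) B_k_carrier(2)[OF cB(1)[of 0], of t] by (auto simp: V_def V'_def velocity_def)
  have dF: "(F has_vector_derivative fH t - fB t) (at t)" if t: "t \<in> {l1<..<l2}" for t
  proof -
    have loc: "fst (PHI b 1) t = fst (gauge (total_gauge b) (fst b, snd b)) t"
      "snd (PHI b 1) t = snd (gauge (total_gauge b) (fst b, snd b)) t" if "b \<in> slice" for b
      using Phi_first[OF that t] by simp_all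
    show ?thesis
      unfolding F_def fH_def fB_def x_def y_def W_def W'_def V_def V'_def
      by (rule form_variation[OF C C' t]) (use c0 loc cB in simp_all)
  qed
  have Fl: "\<forall>\<^sub>F t in at_right l1. F t = 0"
  proof -
    have "\<forall>\<^sub>F t in at_right l1. t \<in> {l1<..<l2}"
      by (rule eventually_at_right_real) (use l2 in simp)
    with xl yl show ?thesis
    proof eventually_elim
      case (elim t)
      have z: "mtrace (0\<^sub>m m m) = 0" "0\<^sub>m m m - 0\<^sub>m m m = (0\<^sub>m m m :: complex mat)"
        by (auto simp: mtrace_def)
      show ?case using elim bc[OF elim(3)] by (simp add: F_def x_def y_def z)
    qed
  qed
  have Fr: "F t = 0" if te: "t \<in> right_end" and tl: "t < l2" for t
  proof -
    have t: "t \<in> {l1<..<l2}" and tJ: "t \<in> J" using te tl l2(1,3) by simp_all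
    note r = g_reg_props(2)[OF tJ]
    obtain Y where Y: "supported_on m (block_lower n k) Y" "x t = minv (g_reg t) * Y * g_reg t"
      using xr[OF te tl] unfolding x_def by blast
    obtain Y' where Y': "supported_on m (block_lower n k) Y'" "y t = minv (g_reg t) * Y' * g_reg t"
      using yr[OF te tl] unfolding y_def by blast
    have "mtrace (y t * snd V t) - mtrace (x t * snd V' t) - mtrace ((x t * y t - y t * x t) * snd (c 0) t) = 0"
      by (rule boundary_term_vanishes[OF GL_carrier[OF r] minv_GL[OF r] bc(2,3,1)[OF t] transp_block_lower Y(1) Y'(1)
            _ _ _ Y(2) Y'(2)])
         (use step1_velocity_vanishes[OF c te] step1_velocity_vanishes[OF c' te] step1_beta_vanishes[OF cB(1) te]
           in \<open>auto simp: V_def V'_def\<close>)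
    then show ?thesis by (simp add: F_def)
  qed
  (* F vanishes near both ends of the first interval, so its extension by 0 is continuous on the
     closed interval *)
  define E where "E = (\<lambda>t. if t \<in> {l1<..<l2} then F t else 0)"
  have dE: "(E has_vector_derivative fH t - fB t) (at t)" if t: "t \<in> {l1<..<l2}" for t
    by (rule has_vector_derivative_transform_within_open[OF dF[OF t], of "{l1<..<l2}"]) (use t in \<open>auto simp: E_def\<close>)
  have l12: "l1 < l2" using l2 by simp
  have cont: "continuous_on {l1..l2} E"
    unfolding continuous_on_eq_continuous_within
  proof
    fix t assume "t \<in> {l1..l2}"
    then consider "t = l1" | "t = l2" | "t \<in> {l1<..<l2}" by fastforce
    then show "continuous (at t within {l1..l2}) E"
    proof cases
      case 1
      have "\<forall>\<^sub>F t in at_right l1. E t = 0" using Fl by eventually_elim (simp add: E_def)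
      then show ?thesis
        using l12 by (simp add: 1 continuous_within at_within_Icc_at_right E_def[THEN fun_cong, of l1] tendsto_eventually)
    next
      case 2
      have "\<forall>\<^sub>F t in at_left l2. t \<in> {lN - real n * eps<..<l2}"
        by (rule eventually_at_left_real) (use l2 in simp)
      then have "\<forall>\<^sub>F t in at_left l2. E t = 0"
        by eventually_elim (use Fr l2(3) in \<open>simp add: E_def\<close>)
      then show ?thesis
        using l12 by (simp add: 2 continuous_within at_within_Icc_at_left E_def[THEN fun_cong, of l2] tendsto_eventually)
    next
      case 3
      then show ?thesis
        using dE has_vector_derivative_continuous continuous_at_imp_continuous_at_within by blast
    qed
  qed
  have "((\<lambda>t. fH t - fB t) has_integral (E l2 - E l1)) {l1..l2}"
    by (rule fundamental_theorem_of_calculus_interior[OF _ cont dE]) (use l12 in auto)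
  then have first: "integral {l1..l2} fH = integral {l1..l2} fB"
    by (intro integral_eq_of_diff) (simp add: E_def)
  have z: "mtrace (0\<^sub>m d d * P - 0\<^sub>m d d * Q) = 0" if "P \<in> carrier_mat d d" "Q \<in> carrier_mat d d" for d P Q
    using that by (auto simp: mtrace_def)
  have "integral {l1..lN} fB = integral {l1..l2} fB"
  proof (rule integral_spike_set)
    have zero: "fB t = 0" if "t \<in> right_end" for t
      unfolding fB_def V_def V'_def velocity_alpha_end[OF cB(1) that] velocity_alpha_end[OF cB(2) that]
      by (rule z) (simp_all add: velocity_def)
    have "t = lN" if "l2 < t" "t \<le> lN" "fB t \<noteq> 0" for t
    proof (rule ccontr)
      assume "t \<noteq> lN"
      then have "t \<in> right_end" using that(1,2) l2(2) by simp
      then show False using zero that(3) by blast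
    qed
    then have "{t \<in> {l1..lN} - {l1..l2}. fB t \<noteq> 0} \<subseteq> {lN}" by auto
    then show "negligible {t \<in> {l1..lN} - {l1..l2}. fB t \<noteq> 0}"
      using negligible_subset[OF negligible_sing] by blast
    have "{t \<in> {l1..l2} - {l1..lN}. fB t \<noteq> 0} = {}" using l2 by auto
    then show "negligible {t \<in> {l1..l2} - {l1..lN}. fB t \<noteq> 0}" by (simp only: negligible_empty)
  qed
  then have B: "omega_B l1 lN (velocity m c) (velocity m c') = integral {l1..l2} fB"
    by (simp add: omega_B_def form_on_def fB_def V_def V'_def)
  have rest: "form_on (lam n l1 lN eps i) (lam n l1 lN eps (i+1))
      (velocity (msize n k i) (\<lambda>s. PHI (c s) i)) (velocity (msize n k i) (\<lambda>s. PHI (c' s) i)) = 0"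
    if i: "i \<in> {1..n} - {1}" for i
  proof -
    have i2: "2 \<le> i" "i \<le> n" using i by auto
    let ?f = "\<lambda>t. mtrace (fst (velocity (msize n k i) (\<lambda>s. PHI (c s) i)) t * snd (velocity (msize n k i) (\<lambda>s. PHI (c' s) i)) t
       - fst (velocity (msize n k i) (\<lambda>s. PHI (c' s) i)) t * snd (velocity (msize n k i) (\<lambda>s. PHI (c s) i)) t)"
    let ?p = "lam n l1 lN eps i" and ?q = "lam n l1 lN eps (i+1)"
    have "?f t = 0" if "t \<in> {?p<..<?q}" for t
    proof -
      have tI: "t \<in> I_open n l1 lN eps i" using that by (simp only: I_open_def)
      show ?thesis
        unfolding velocity_Phi_end[OF cB(1) i2 tI] velocity_Phi_end[OF cB(2) i2 tI]
        by (rule z) (simp_all add: velocity_def)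
    qed
    then have "integral {?p..?q} ?f = 0" by (rule integral_eq_0_if_0_inside)
    then show ?thesis by (simp add: form_on_def)
  qed
  have "omega_H n l1 lN eps (\<lambda>i. velocity (msize n k i) (\<lambda>s. PHI (c s) i))
       (\<lambda>i. velocity (msize n k i) (\<lambda>s. PHI (c' s) i))
     = form_on (lam n l1 lN eps 1) (lam n l1 lN eps (1+1)) W W'"
    unfolding omega_H_def W_def W'_def using n rest by (subst sum.remove[of _ 1]) (simp_all del: One_nat_def)
  also have "\<dots> = integral {l1..l2} fH" by (simp add: form_on_def fH_def lam_1)
  finally show ?thesis using first B by simp
qed

end

theorem proposition6p1:
  fixes n :: nat and k :: "nat \<Rightarrow> nat" and l1 lN eps :: real
    and g_reg :: mat_fun and g :: "nahm_pair \<Rightarrow> mat_fun" and g_H :: "nat \<Rightarrow> mat_fun"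
    and Psi :: "nahm_data set \<Rightarrow> hurtubise_data set"
  assumes n: "n \<ge> 2"
    and k_antimono: "\<And>i. 1 \<le> i \<Longrightarrow> i < n \<Longrightarrow> k (i + 1) \<le> k i"
    and k_pos: "k n \<ge> 1"
    and eps: "eps > 0" "lN - real n * eps > l1"
    and g_reg: "is_g_reg n k l1 lN eps g_reg"
    and g: "is_g_choice n k l1 lN eps g_reg g"
    and g_H: "is_g_H n k l1 lN eps g_H"
    and Psi_bij: "bij_betw Psi (N_k n k l1 lN) (N_H n k l1 lN eps)"
    and Psi_induced: "\<And>b. b \<in> B_k n k l1 lN eps \<Longrightarrow>
          Psi (class_k n k l1 lN b) = class_H n k l1 lN eps (Phi n k g_reg g g_H b)"
  shows "\<forall>c c'. B_k_curve n k l1 lN eps c \<and> B_k_curve n k l1 lN eps c' \<and> c 0 = c' 0 \<longrightarrow>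
     omega_H n l1 lN eps
       (\<lambda>i. velocity (msize n k i) (\<lambda>s. Phi n k g_reg g g_H (c s) i))
       (\<lambda>i. velocity (msize n k i) (\<lambda>s. Phi n k g_reg g g_H (c' s) i))
     = omega_B l1 lN (velocity (msize n k 1) c) (velocity (msize n k 1) c')"
proof -
  interpret construction n k l1 lN eps g_reg g g_H
    by unfold_locales (rule n k_antimono eps g_reg g g_H; assumption)+
  show ?thesis using pullback_form by blast
qed

end
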